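(* Let $\mathcal X\subset\mathcal M$ be a symplectic leaf of real dimension $2n$ with a Kähler form $\omega$, $\frac1{2\pi\hbar}[\omega]\in H^2(\mathcal X,\mathbb Z)$, a corresponding reproducing measure $dm$, the Wick product $*$ over $\mathcal X$, and a quantum restriction $f\mapsto f|_{\widehat{\mathcal X}}$ satisfying $f|_{\widehat{\mathcal X}}*g|_{\widehat{\mathcal X}}=(f\star g)|_{\widehat{\mathcal X}}$. Let $\pi_{\mathcal X}(f)=\widehat{f|_{\widehat{\mathcal X}}}$ be the corresponding representation of the algebra $\mathcal F_\star(\mathcal M)$ in $\mathcal L(\mathcal X)$. Then, for $f$ such that $\pi_{\mathcal X}(f)$ has a trace, $$\operatorname{tr}\pi_{\mathcal X}(f)=\frac1{(2\pi\hbar)^n}\int_{\mathcal X}f\big|_{\widehat{\mathcal X}}\,dm,\qquad\dim\pi_{\mathcal X}=\frac1{(2\pi\hbar)^n}\int_{\mathcal X}dm .$$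
   Context: Let $\hbar>0$. $\mathcal F_\star(\mathcal M)$ is an algebra of functions over a manifold $\mathcal M$ with associative product $\star$ deforming the usual one ($f\star g=fg+\hbar c_1(f,g)+\dots$), with unity $1$ and involution given by complex conjugation; $\mathcal M$ carries the Poisson bracket $\{f,g\}=i(c_1(f,g)-c_1(g,f))$. Over $\mathcal X$ consider the Hermitian line bundle with curvature $i\omega/\hbar$, fiber form $(u,v)_\hbar=u\bar v\,e^{-F/\hbar}$, where locally $\omega=i\bar\partial\partial F$. $\mathcal L(\mathcal X)$ is the Hilbert space of antiholomorphic sections with $\|u\|^2=\frac1{(2\pi\hbar)^n}\int(u,u)_\hbar\,dm$; with an orthonormal basis $\{u_j\}$ put $\mathcal K=\sum_j|u_j|^2$, $\mathcal K^{\#}(x|y)=\sum_ju_j(x)\overline{u_j(y)}$. The measure $dm$ is the reproducing measure corresponding to $\omega$: $i\hbar\bar\partial\partial\ln\mathcal K=\omega$, normalized by $\mathcal K=e^{F/\hbar}$. For a function $\psi$ on $\mathcal X$ with extension $\psi^{\#}(x|y)$ to $\mathcal X\times\mathcal X$, antiholomorphic in $x$ and holomorphic in $y$, $\psi^{\#}(x|x)=\psi(x)$, the Wick operator $\widehat\psi$ is $$(\widehat\psi u)(x)=\frac1{(2\pi\hbar)^n}\int_{\mathcal X}\mathcal K^{\#}(x|y)\psi^{\#}(x|y)u(y)e^{-F(y)/\hbar}\,dm(y),$$ and the Wick product is $(\psi*\chi)(x)=\frac1{(2\pi\hbar)^n}\int_{\mathcal X}\frac{|\mathcal K^{\#}(x|y)|^2}{\mathcal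 K(x)\mathcal K(y)}\psi^{\#}(x|y)\chi^{\#}(y|x)\,dm(y)$, so that $\widehat\psi\,\widehat\chi=\widehat{\psi*\chi}$. A quantum restriction is an operation $f\mapsto f|_{\widehat{\mathcal X}}=f|_{\mathcal X}+\hbar e_1(f)+\hbar^2e_2(f)+\dots$ (with $e_j$ differential operators) from functions on $\mathcal M$ to functions on $\mathcal X$; it sends the unity function $1$ to $1$. *)

theory Defs
  imports "HOL-Analysis.Analysis" "HOL-Library.Landau_Symbols"
begin

section \<open>Smooth and complex manifolds\<close>

text \<open>
  A manifold is a second countable Hausdorff type together with an atlas. A chart is a pair of
  its open domain and its coordinate map.
\<close>

primrec k_smooth_on ::
  "nat \<Rightarrow> 'a::real_normed_vector set \<Rightarrow> ('a \<Rightarrow> 'b::real_normed_vector) \<Rightarrow> bool" where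
  "k_smooth_on 0 S f \<longleftrightarrow> continuous_on S f"
| "k_smooth_on (Suc k) S f \<longleftrightarrow>
     (\<forall>x\<in>S. f differentiable (at x)) \<and>
     (\<forall>v. k_smooth_on k S (\<lambda>x. frechet_derivative f (at x) v))"

definition smooth_on ::
  "'a::real_normed_vector set \<Rightarrow> ('a \<Rightarrow> 'b::real_normed_vector) \<Rightarrow> bool" where
  "smooth_on S f \<longleftrightarrow> (\<forall>k. k_smooth_on k S f)"

type_synonym ('p, 'e) chart = "'p set \<times> ('p \<Rightarrow> 'e)"

definition inv_chart :: "('p, 'e) chart \<Rightarrow> 'e \<Rightarrow> 'p" where
  "inv_chart c = inv_into (fst c) (snd c)"

definition chart_image :: "('p, 'e) chart \<Rightarrow> 'p set \<Rightarrow> 'e set" where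
  "chart_image c W = snd c ` (fst c \<inter> W)"

definition is_chart :: "('p::topological_space, 'e::topological_space) chart \<Rightarrow> bool" where
  "is_chart c \<longleftrightarrow> open (fst c) \<and> open (chart_image c UNIV) \<and>
     homeomorphism (fst c) (chart_image c UNIV) (snd c) (inv_chart c)"

definition smooth_atlas ::
  "('p::topological_space, 'e::euclidean_space) chart set \<Rightarrow> bool" where
  "smooth_atlas A \<longleftrightarrow> (\<forall>c\<in>A. is_chart c) \<and> (\<Union>c\<in>A. fst c) = UNIV \<and>
     (\<forall>c\<in>A. \<forall>d\<in>A. smooth_on (chart_image c (fst d)) (snd d \<circ> inv_chart c))"

definition complex_atlas ::
  "('p::topological_space, complex ^ 'n::finite) chart set \<Rightarrow> bool" where
  "complex_atlas A \<longleftrightarrow> smooth_atlas A \<and>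
     (\<forall>c\<in>A. \<forall>d\<in>A. \<forall>z\<in>chart_image c (fst d). \<exists>D.
        ((snd d \<circ> inv_chart c) has_derivative D) (at z) \<and> (\<forall>v. D (\<i> *s v) = \<i> *s D v))"

definition smooth_fun_on ::
  "('p, 'e::euclidean_space) chart set \<Rightarrow> 'p set \<Rightarrow> ('p \<Rightarrow> 'b::real_normed_vector) \<Rightarrow> bool" where
  "smooth_fun_on A W f \<longleftrightarrow> (\<forall>c\<in>A. smooth_on (chart_image c W) (f \<circ> inv_chart c))"

abbreviation smooth_functions :: "('p, 'e::euclidean_space) chart set \<Rightarrow> ('p \<Rightarrow> complex) set" where
  "smooth_functions A \<equiv> {f. smooth_fun_on A UNIV f}"

text \<open>The next two predicates are only used for open \<open>W\<close>.\<close>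

definition holomorphic_fun_on ::
  "('p, complex ^ 'n::finite) chart set \<Rightarrow> 'p set \<Rightarrow> ('p \<Rightarrow> complex) \<Rightarrow> bool" where
  "holomorphic_fun_on A W f \<longleftrightarrow> (\<forall>c\<in>A. \<forall>z\<in>chart_image c W. \<exists>D.
     ((f \<circ> inv_chart c) has_derivative D) (at z) \<and> (\<forall>v. D (\<i> *s v) = \<i> * D v))"

definition antiholomorphic_fun_on ::
  "('p, complex ^ 'n::finite) chart set \<Rightarrow> 'p set \<Rightarrow> ('p \<Rightarrow> complex) \<Rightarrow> bool" where
  "antiholomorphic_fun_on A W f \<longleftrightarrow> (\<forall>c\<in>A. \<forall>z\<in>chart_image c W. \<exists>D.
     ((f \<circ> inv_chart c) has_derivative D) (at z) \<and> (\<forall>v. D (\<i> *s v) = - \<i> * D v))"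

definition injective_immersion ::
  "('x::topological_space, 'e::euclidean_space) chart set \<Rightarrow>
   ('m::topological_space, 'f::euclidean_space) chart set \<Rightarrow> ('x \<Rightarrow> 'm) \<Rightarrow> bool" where
  "injective_immersion AX AM \<iota> \<longleftrightarrow> inj \<iota> \<and> continuous_on UNIV \<iota> \<and>
     (\<forall>c\<in>AX. \<forall>d\<in>AM.
        smooth_on (chart_image c (\<iota> -` fst d)) (snd d \<circ> \<iota> \<circ> inv_chart c) \<and>
        (\<forall>z\<in>chart_image c (\<iota> -` fst d).
           inj (frechet_derivative (snd d \<circ> \<iota> \<circ> inv_chart c) (at z))))"

section \<open>Poisson brackets and symplectic leaves\<close>

definition poisson_bracket ::
  "('m, 'f::euclidean_space) chart set \<Rightarrow>
   (('m \<Rightarrow> complex) \<Rightarrow> ('m \<Rightarrow> complex) \<Rightarrow> ('m \<Rightarrow> complex)) \<Rightarrow> bool" where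
  "poisson_bracket A br \<longleftrightarrow>
     (\<forall>f\<in>smooth_functions A. \<forall>g\<in>smooth_functions A.
        br f g \<in> smooth_functions A \<and>
        (\<forall>p. br g f p = - br f g p) \<and>
        (\<forall>p. br (cnj \<circ> f) (cnj \<circ> g) p = cnj (br f g p)) \<and>
        (\<forall>k\<in>smooth_functions A. \<forall>p.
           (\<forall>a. br (\<lambda>q. a * f q + g q) k p = a * br f k p + br g k p) \<and>
           br f (\<lambda>q. g q * k q) p = br f g p * k p + g p * br f k p \<and>
           br f (br g k) p + br g (br k f) p + br k (br f g) p = 0))"

definition hamiltonian_curve ::
  "('m, 'f::euclidean_space) chart set \<Rightarrow>
   (('m \<Rightarrow> complex) \<Rightarrow> ('m \<Rightarrow> complex) \<Rightarrow> ('m \<Rightarrow> complex)) \<Rightarrow> (real \<Rightarrow> 'm) \<Rightarrow> bool" where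
  "hamiltonian_curve A br \<gamma> \<longleftrightarrow>
     (\<exists>H\<in>smooth_functions A. (\<forall>p. H p \<in> \<real>) \<and>
        (\<forall>f\<in>smooth_functions A. \<forall>t\<in>{0..1}.
           ((\<lambda>t. f (\<gamma> t)) has_vector_derivative br f H (\<gamma> t)) (at t within {0..1})))"

text \<open>The leaf through \<open>p\<close>: all points joined to \<open>p\<close> by piecewise Hamiltonian curves.\<close>

definition symplectic_leaf_through ::
  "('m, 'f::euclidean_space) chart set \<Rightarrow>
   (('m \<Rightarrow> complex) \<Rightarrow> ('m \<Rightarrow> complex) \<Rightarrow> ('m \<Rightarrow> complex)) \<Rightarrow> 'm \<Rightarrow> 'm set" where
  "symplectic_leaf_through A br p =
     {q. (p, q) \<in> {(\<gamma> 0, \<gamma> 1) | \<gamma>. hamiltonian_curve A br \<gamma>}\<^sup>*}"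

text \<open>
  A symplectic leaf is in general only an immersed submanifold, so it is given by a manifold
  \<open>'x\<close> (which carries the leaf topology) and its inclusion map \<open>\<iota>\<close>.
\<close>

definition symplectic_leaf ::
  "('m::topological_space, 'f::euclidean_space) chart set \<Rightarrow>
   (('m \<Rightarrow> complex) \<Rightarrow> ('m \<Rightarrow> complex) \<Rightarrow> ('m \<Rightarrow> complex)) \<Rightarrow>
   ('x::topological_space, 'e::euclidean_space) chart set \<Rightarrow> ('x \<Rightarrow> 'm) \<Rightarrow> bool" where
  "symplectic_leaf AM br AX \<iota> \<longleftrightarrow> injective_immersion AX AM \<iota> \<and>
     (\<exists>p. range \<iota> = symplectic_leaf_through AM br p)"

section \<open>The algebra of functions and quantum restriction\<close>

text \<open>
  \<open>s(h) = a\<^sub>0 + h a\<^sub>1 + h\<^sup>2 a\<^sub>2 + ...\<close> is read as an asymptotic expansion as \<open>h\<close> tends to \<open>0\<close> in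
  the set \<open>Hs\<close> of admissible values of Planck's constant. The algebra laws and the product
  identity are only used at the actual value \<open>h\<close>.
\<close>

definition h_expansion :: "real set \<Rightarrow> (real \<Rightarrow> complex) \<Rightarrow> (nat \<Rightarrow> complex) \<Rightarrow> bool" where
  "h_expansion Hs s a \<longleftrightarrow>
     (\<forall>N. (\<lambda>h. s h - (\<Sum>k<N. of_real (h ^ k) * a k)) \<in> O[at 0 within Hs](\<lambda>h. of_real (h ^ N)))"

definition star_algebra ::
  "('m, 'f::euclidean_space) chart set \<Rightarrow> ('m \<Rightarrow> complex) set \<Rightarrow>
   (('m \<Rightarrow> complex) \<Rightarrow> ('m \<Rightarrow> complex) \<Rightarrow> ('m \<Rightarrow> complex)) \<Rightarrow> bool" where
  "star_algebra A F st \<longleftrightarrow>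
     F \<subseteq> smooth_functions A \<and> (\<lambda>_. 1) \<in> F \<and>
     (\<forall>f\<in>F. (cnj \<circ> f) \<in> F \<and> st (\<lambda>_. 1) f = f \<and> st f (\<lambda>_. 1) = f) \<and>
     (\<forall>f\<in>F. \<forall>g\<in>F. st f g \<in> F \<and> (\<forall>a. (\<lambda>p. a * f p + g p) \<in> F) \<and>
        cnj \<circ> st f g = st (cnj \<circ> g) (cnj \<circ> f) \<and>
        (\<forall>k\<in>F. st (st f g) k = st f (st g k) \<and>
           (\<forall>a. st (\<lambda>p. a * f p + g p) k = (\<lambda>p. a * st f k p + st g k p) \<and>
                st k (\<lambda>p. a * f p + g p) = (\<lambda>p. a * st k f p + st k g p))))"

text \<open>
  The product \<open>star h\<close> deforms the usual one, with coefficients \<open>c k\<close>, and induces the Poisson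
  bracket \<open>br\<close>.
\<close>

definition star_deformation ::
  "real set \<Rightarrow> ('m \<Rightarrow> complex) set \<Rightarrow>
   (real \<Rightarrow> ('m \<Rightarrow> complex) \<Rightarrow> ('m \<Rightarrow> complex) \<Rightarrow> ('m \<Rightarrow> complex)) \<Rightarrow>
   (nat \<Rightarrow> ('m \<Rightarrow> complex) \<Rightarrow> ('m \<Rightarrow> complex) \<Rightarrow> ('m \<Rightarrow> complex)) \<Rightarrow>
   (('m \<Rightarrow> complex) \<Rightarrow> ('m \<Rightarrow> complex) \<Rightarrow> ('m \<Rightarrow> complex)) \<Rightarrow> bool" where
  "star_deformation Hs F star c br \<longleftrightarrow>
     (\<forall>f\<in>F. \<forall>g\<in>F. \<forall>p.
        h_expansion Hs (\<lambda>h. star h f g p) (\<lambda>k. c k f g p) \<and>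
        c 0 f g p = f p * g p \<and>
        br f g p = \<i> * (c 1 f g p - c 1 g f p))"

text \<open>
  Differential operators from functions on \<open>'m\<close> to functions on \<open>'x\<close>, in the algebraic form
  (order at most \<open>k + 1\<close> iff all commutators with multiplications have order at most \<open>k\<close>);
  functions on \<open>'m\<close> act on functions on \<open>'x\<close> through \<open>\<iota>\<close>.
\<close>

primrec has_order ::
  "nat \<Rightarrow> ('m \<Rightarrow> complex) set \<Rightarrow> ('x \<Rightarrow> 'm) \<Rightarrow> (('m \<Rightarrow> complex) \<Rightarrow> ('x \<Rightarrow> complex)) \<Rightarrow> bool" where
  "has_order 0 C \<iota> D \<longleftrightarrow>
     (\<forall>g\<in>C. \<forall>f\<in>C. \<forall>x. D (\<lambda>p. g p * f p) x = g (\<iota> x) * D f x)"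
| "has_order (Suc k) C \<iota> D \<longleftrightarrow>
     (\<forall>g\<in>C. has_order k C \<iota> (\<lambda>f x. D (\<lambda>p. g p * f p) x - g (\<iota> x) * D f x))"

definition differential_operator ::
  "('m, 'f::euclidean_space) chart set \<Rightarrow> ('x, 'e::euclidean_space) chart set \<Rightarrow> ('x \<Rightarrow> 'm) \<Rightarrow>
   (('m \<Rightarrow> complex) \<Rightarrow> ('x \<Rightarrow> complex)) \<Rightarrow> bool" where
  "differential_operator AM AX \<iota> D \<longleftrightarrow>
     (\<forall>f\<in>smooth_functions AM. D f \<in> smooth_functions AX) \<and>
     (\<forall>f\<in>smooth_functions AM. \<forall>g\<in>smooth_functions AM. \<forall>a x.
        D (\<lambda>p. a * f p + g p) x = a * D f x + D g x) \<and>
     (\<exists>k. has_order k (smooth_functions AM) \<iota> D)"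

definition quantum_restriction ::
  "real \<Rightarrow> real set \<Rightarrow> ('m, 'f::euclidean_space) chart set \<Rightarrow>
   ('x, 'e::euclidean_space) chart set \<Rightarrow> ('x \<Rightarrow> 'm) \<Rightarrow> ('m \<Rightarrow> complex) set \<Rightarrow>
   (real \<Rightarrow> ('m \<Rightarrow> complex) \<Rightarrow> ('x \<Rightarrow> complex)) \<Rightarrow>
   (nat \<Rightarrow> ('m \<Rightarrow> complex) \<Rightarrow> ('x \<Rightarrow> complex)) \<Rightarrow> bool" where
  "quantum_restriction h Hs AM AX \<iota> F rest e \<longleftrightarrow>
     (\<forall>k. differential_operator AM AX \<iota> (e k)) \<and>
     (\<forall>f\<in>smooth_functions AM. e 0 f = f \<circ> \<iota>) \<and>
     (\<forall>f\<in>F. \<forall>x. h_expansion Hs (\<lambda>h'. rest h' f x) (\<lambda>k. e k f x)) \<and>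
     (\<forall>f\<in>F. rest h f \<in> smooth_functions AX) \<and>
     (\<forall>f\<in>F. \<forall>g\<in>F. \<forall>a. rest h (\<lambda>p. a * f p + g p) = (\<lambda>x. a * rest h f x + rest h g x)) \<and>
     rest h (\<lambda>_. 1) = (\<lambda>_. 1)"

section \<open>Kaehler forms\<close>

text \<open>
  Differential forms are given by their expressions in the charts of the atlas: \<open>\<omega> c x\<close> is the
  form at the point \<open>x\<close>, as a function of tangent vectors written in the coordinates of \<open>c\<close>.
\<close>

type_synonym ('x, 'n) one_form =
  "('x, complex ^ 'n) chart \<Rightarrow> 'x \<Rightarrow> complex ^ 'n \<Rightarrow> real"
type_synonym ('x, 'n) two_form =
  "('x, complex ^ 'n) chart \<Rightarrow> 'x \<Rightarrow> complex ^ 'n \<Rightarrow> complex ^ 'n \<Rightarrow> real"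

definition transition_deriv ::
  "('x, complex ^ 'n::finite) chart \<Rightarrow> ('x, complex ^ 'n) chart \<Rightarrow> 'x \<Rightarrow> complex ^ 'n \<Rightarrow> complex ^ 'n"
  where
  "transition_deriv c d x = frechet_derivative (snd d \<circ> inv_chart c) (at (snd c x))"

definition one_form_on ::
  "('x, complex ^ 'n::finite) chart set \<Rightarrow> 'x set \<Rightarrow> ('x, 'n) one_form \<Rightarrow> bool" where
  "one_form_on A W \<theta> \<longleftrightarrow> (\<forall>c\<in>A.
     (\<forall>x\<in>fst c \<inter> W. linear (\<theta> c x)) \<and>
     (\<forall>v. smooth_on (chart_image c W) (\<lambda>z. \<theta> c (inv_chart c z) v)) \<and>
     (\<forall>d\<in>A. \<forall>x\<in>fst c \<inter> fst d \<inter> W. \<forall>v. \<theta> c x v = \<theta> d x (transition_deriv c d x v)))"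

definition exterior_derivative :: "('x, 'n::finite) one_form \<Rightarrow> ('x, 'n) two_form" where
  "exterior_derivative \<theta> c x v w =
     frechet_derivative (\<lambda>z. \<theta> c (inv_chart c z) w) (at (snd c x)) v -
     frechet_derivative (\<lambda>z. \<theta> c (inv_chart c z) v) (at (snd c x)) w"

definition closed_two_form ::
  "('x, complex ^ 'n::finite) chart set \<Rightarrow> ('x, 'n) two_form \<Rightarrow> bool" where
  "closed_two_form A \<omega> \<longleftrightarrow> (\<forall>c\<in>A.
     (\<forall>x\<in>fst c. bilinear (\<omega> c x) \<and> (\<forall>v. \<omega> c x v v = 0)) \<and>
     (\<forall>v w. smooth_on (chart_image c UNIV) (\<lambda>z. \<omega> c (inv_chart c z) v w)) \<and>
     (\<forall>d\<in>A. \<forall>x\<in>fst c \<inter> fst d. \<forall>v w.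
        \<omega> c x v w = \<omega> d x (transition_deriv c d x v) (transition_deriv c d x w)) \<and>
     (\<forall>x\<in>fst c. \<forall>u v w.
        frechet_derivative (\<lambda>z. \<omega> c (inv_chart c z) v w) (at (snd c x)) u +
        frechet_derivative (\<lambda>z. \<omega> c (inv_chart c z) w u) (at (snd c x)) v +
        frechet_derivative (\<lambda>z. \<omega> c (inv_chart c z) u v) (at (snd c x)) w = 0))"

text \<open>
  The convention is \<open>\<omega> = i dbar d F\<close> (not \<open>i d dbar F\<close>) with plurisubharmonic \<open>F\<close>, so positivity
  of the Kaehler metric reads \<open>\<omega>(iv, v) > 0\<close>.
\<close>

definition kahler_form ::
  "('x, complex ^ 'n::finite) chart set \<Rightarrow> ('x, 'n) two_form \<Rightarrow> bool" where
  "kahler_form A \<omega> \<longleftrightarrow> closed_two_form A \<omega> \<and>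
     (\<forall>c\<in>A. \<forall>x\<in>fst c.
        (\<forall>v w. \<omega> c x (\<i> *s v) (\<i> *s w) = \<omega> c x v w) \<and>
        (\<forall>v. v \<noteq> 0 \<longrightarrow> \<omega> c x (\<i> *s v) v > 0))"

text \<open>
  \<open>[\<omega>]/r\<close> lies in the image of the integral cohomology: \<open>r\<close> times an integral Cech cocycle
  represents the de Rham class of \<open>\<omega>\<close>. The members \<open>W p\<close> of the open cover are indexed by points.
\<close>

definition integral_class ::
  "('x::topological_space, complex ^ 'n::finite) chart set \<Rightarrow> ('x, 'n) two_form \<Rightarrow> real \<Rightarrow> bool" where
  "integral_class A \<omega> r \<longleftrightarrow> (\<exists>W \<theta> f.
     (\<forall>p::'x. open (W p) \<and> p \<in> W p \<and> one_form_on A (W p) (\<theta> p)) \<and>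
     (\<forall>p. \<forall>c\<in>A. \<forall>x\<in>fst c \<inter> W p. \<forall>v w. \<omega> c x v w = exterior_derivative (\<theta> p) c x v w) \<and>
     (\<forall>p q. smooth_fun_on A (W p \<inter> W q) (f p q :: 'x \<Rightarrow> real)) \<and>
     (\<forall>p q. \<forall>c\<in>A. \<forall>x\<in>fst c \<inter> W p \<inter> W q. \<forall>v.
        \<theta> q c x v - \<theta> p c x v = frechet_derivative (f p q \<circ> inv_chart c) (at (snd c x)) v) \<and>
     (\<forall>p q s. \<forall>x\<in>W p \<inter> W q \<inter> W s. \<exists>k::int. f p q x + f q s x - f p s x = r * of_int k))"

definition d_z :: "'n::finite \<Rightarrow> (complex ^ 'n \<Rightarrow> complex) \<Rightarrow> complex ^ 'n \<Rightarrow> complex" where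
  "d_z k G z =
     (frechet_derivative G (at z) (axis k 1) - \<i> * frechet_derivative G (at z) (axis k \<i>)) / 2"

definition d_zbar :: "'n::finite \<Rightarrow> (complex ^ 'n \<Rightarrow> complex) \<Rightarrow> complex ^ 'n \<Rightarrow> complex" where
  "d_zbar k G z =
     (frechet_derivative G (at z) (axis k 1) + \<i> * frechet_derivative G (at z) (axis k \<i>)) / 2"

text \<open>The 2-form \<open>i dbar d G\<close> at \<open>z\<close>, evaluated on \<open>v\<close> and \<open>w\<close>.\<close>

definition i_dbar_d ::
  "(complex ^ 'n::finite \<Rightarrow> complex) \<Rightarrow> complex ^ 'n \<Rightarrow> complex ^ 'n \<Rightarrow> complex ^ 'n \<Rightarrow> complex" where
  "i_dbar_d G z v w =
     \<i> * (\<Sum>j\<in>UNIV. \<Sum>k\<in>UNIV. d_zbar j (d_z k G) z * (cnj (v $ j) * w $ k - cnj (w $ j) * v $ k))"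

definition kahler_potential ::
  "('x, complex ^ 'n::finite) chart set \<Rightarrow> ('x, 'n) two_form \<Rightarrow> 'x set \<Rightarrow> ('x \<Rightarrow> real) \<Rightarrow> bool" where
  "kahler_potential A \<omega> W F \<longleftrightarrow> smooth_fun_on A W F \<and>
     (\<forall>c\<in>A. \<forall>x\<in>fst c \<inter> W. \<forall>v w.
        of_real (\<omega> c x v w) = i_dbar_d (\<lambda>z. of_real (F (inv_chart c z))) (snd c x) v w)"

section \<open>The Hermitian line bundle and its antiholomorphic sections\<close>

text \<open>
  A line bundle is given by a trivializing cover \<open>patch\<close>, transition functions \<open>glue\<close> and, for the
  Hermitian structure, local potentials \<open>pot\<close>: over \<open>patch i\<close> the fiber form is
  \<open>u\<^sub>i cnj(v\<^sub>i) exp(-pot\<^sub>i/h)\<close>. Since the \<open>pot\<^sub>i\<close> are potentials of \<open>\<omega>\<close>, this encodes the curvature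
  \<open>i \<omega>/h\<close>.
\<close>

record ('i, 'x) line_bundle =
  patch :: "'i \<Rightarrow> 'x set"
  glue :: "'i \<Rightarrow> 'i \<Rightarrow> 'x \<Rightarrow> complex"
  pot :: "'i \<Rightarrow> 'x \<Rightarrow> real"

definition hermitian_line_bundle ::
  "real \<Rightarrow> ('x::topological_space, complex ^ 'n::finite) chart set \<Rightarrow> ('x, 'n) two_form \<Rightarrow>
   ('i, 'x) line_bundle \<Rightarrow> bool" where
  "hermitian_line_bundle h A \<omega> E \<longleftrightarrow>
     (\<forall>i. open (patch E i)) \<and> (\<Union>i. patch E i) = UNIV \<and>
     (\<forall>i j. antiholomorphic_fun_on A (patch E i \<inter> patch E j) (glue E i j)) \<and>
     (\<forall>i. \<forall>x\<in>patch E i. glue E i i x = 1) \<and>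
     (\<forall>i j k. \<forall>x\<in>patch E i \<inter> patch E j \<inter> patch E k. glue E i j x * glue E j k x = glue E i k x) \<and>
     (\<forall>i. kahler_potential A \<omega> (patch E i) (pot E i)) \<and>
     (\<forall>i j. \<forall>x\<in>patch E i \<inter> patch E j.
        exp (- pot E j x / h) = (cmod (glue E i j x))\<^sup>2 * exp (- pot E i x / h))"

text \<open>A section is the family of its local expressions, set to \<open>0\<close> outside the patches.\<close>

type_synonym ('i, 'x) bsection = "'i \<Rightarrow> 'x \<Rightarrow> complex"

definition antiholomorphic_section ::
  "('x, complex ^ 'n::finite) chart set \<Rightarrow> ('i, 'x) line_bundle \<Rightarrow> ('i, 'x) bsection \<Rightarrow> bool" where
  "antiholomorphic_section A E u \<longleftrightarrow>
     (\<forall>i x. x \<notin> patch E i \<longrightarrow> u i x = 0) \<and>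
     (\<forall>i. antiholomorphic_fun_on A (patch E i) (u i)) \<and>
     (\<forall>i j. \<forall>x\<in>patch E i \<inter> patch E j. u i x = glue E i j x * u j x)"

text \<open>
  Pointwise quantities below are evaluated in the patch \<open>triv E x\<close> chosen around \<open>x\<close>; they do not
  depend on this choice.
\<close>

definition triv :: "('i, 'x) line_bundle \<Rightarrow> 'x \<Rightarrow> 'i" where
  "triv E x = (SOME i. x \<in> patch E i)"

definition fiber_form ::
  "real \<Rightarrow> ('i, 'x) line_bundle \<Rightarrow> ('i, 'x) bsection \<Rightarrow> ('i, 'x) bsection \<Rightarrow> 'x \<Rightarrow> complex" where
  "fiber_form h E u v x =
     (let i = triv E x in u i x * cnj (v i x) * of_real (exp (- pot E i x / h)))"

definition section_space ::
  "real \<Rightarrow> ('x, complex ^ 'n::finite) chart set \<Rightarrow> ('i, 'x) line_bundle \<Rightarrow> 'x measure \<Rightarrow>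
   ('i, 'x) bsection set" where
  "section_space h A E m =
     {u. antiholomorphic_section A E u \<and> integrable m (fiber_form h E u u)}"

definition section_ip ::
  "real \<Rightarrow> nat \<Rightarrow> ('i, 'x) line_bundle \<Rightarrow> 'x measure \<Rightarrow>
   ('i, 'x) bsection \<Rightarrow> ('i, 'x) bsection \<Rightarrow> complex" where
  "section_ip h n E m u v = of_real (1 / (2 * pi * h) ^ n) * (LINT x|m. fiber_form h E u v x)"

section \<open>Hilbert spaces, trace and dimension\<close>

type_synonym ('i, 'x) inner_product = "('i, 'x) bsection \<Rightarrow> ('i, 'x) bsection \<Rightarrow> complex"

definition ip_norm :: "('i, 'x) inner_product \<Rightarrow> ('i, 'x) bsection \<Rightarrow> real" where
  "ip_norm ip u = sqrt (Re (ip u u))"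

definition ip_dist :: "('i, 'x) inner_product \<Rightarrow> ('i, 'x) bsection \<Rightarrow> ('i, 'x) bsection \<Rightarrow> real" where
  "ip_dist ip u v = ip_norm ip (\<lambda>i x. u i x - v i x)"

definition hilbert_space :: "('i, 'x) bsection set \<Rightarrow> ('i, 'x) inner_product \<Rightarrow> bool" where
  "hilbert_space V ip \<longleftrightarrow>
     (\<lambda>_ _. 0) \<in> V \<and>
     (\<forall>u\<in>V. \<forall>v\<in>V. \<forall>a. (\<lambda>i x. a * u i x + v i x) \<in> V) \<and>
     (\<forall>u\<in>V. \<forall>v\<in>V. ip v u = cnj (ip u v)) \<and>
     (\<forall>u\<in>V. \<forall>v\<in>V. \<forall>w\<in>V. \<forall>a. ip (\<lambda>i x. a * u i x + v i x) w = a * ip u w + ip v w) \<and>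
     (\<forall>u\<in>V. Re (ip u u) \<ge> 0) \<and>
     (\<forall>u\<in>V. ip u u = 0 \<longrightarrow> u = (\<lambda>_ _. 0)) \<and>
     (\<forall>s::nat \<Rightarrow> ('i, 'x) bsection.
        (\<forall>k. s k \<in> V) \<and> (\<forall>\<epsilon>>0. \<exists>N. \<forall>k\<ge>N. \<forall>l\<ge>N. ip_dist ip (s k) (s l) < \<epsilon>) \<longrightarrow>
        (\<exists>u\<in>V. (\<lambda>k. ip_dist ip (s k) u) \<longlonglongrightarrow> 0))"

definition orthonormal_basis ::
  "('i, 'x) bsection set \<Rightarrow> ('i, 'x) inner_product \<Rightarrow> ('i, 'x) bsection set \<Rightarrow> bool" where
  "orthonormal_basis V ip B \<longleftrightarrow> B \<subseteq> V \<and>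
     (\<forall>b\<in>B. \<forall>b'\<in>B. ip b b' = (if b = b' then 1 else 0)) \<and>
     (\<forall>u\<in>V. \<forall>\<epsilon>>0. \<exists>S a. finite S \<and> S \<subseteq> B \<and> ip_dist ip u (\<lambda>i x. \<Sum>b\<in>S. a b * b i x) < \<epsilon>)"

text \<open>Trace class (nuclear) operators: sums of rank one operators, convergent in trace norm.\<close>

definition trace_class ::
  "('i, 'x) bsection set \<Rightarrow> ('i, 'x) inner_product \<Rightarrow>
   (('i, 'x) bsection \<Rightarrow> ('i, 'x) bsection) \<Rightarrow> bool" where
  "trace_class V ip T \<longleftrightarrow> (\<forall>u\<in>V. T u \<in> V) \<and>
     (\<exists>a b. (\<forall>k::nat. a k \<in> V \<and> b k \<in> V) \<and>
        summable (\<lambda>k. ip_norm ip (a k) * ip_norm ip (b k)) \<and>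
        (\<forall>u\<in>V. (\<lambda>N. ip_dist ip (T u) (\<lambda>i x. \<Sum>k<N. ip u (b k) * a k i x)) \<longlonglongrightarrow> 0))"

definition op_trace ::
  "('i, 'x) bsection set \<Rightarrow> ('i, 'x) inner_product \<Rightarrow>
   (('i, 'x) bsection \<Rightarrow> ('i, 'x) bsection) \<Rightarrow> complex" where
  "op_trace V ip T =
     (THE t. \<forall>B. orthonormal_basis V ip B \<longrightarrow> ((\<lambda>b. ip (T b) b) has_sum t) B)"

definition hilbert_dim :: "('i, 'x) bsection set \<Rightarrow> ('i, 'x) inner_product \<Rightarrow> ennreal" where
  "hilbert_dim V ip =
     (THE d. \<forall>B. orthonormal_basis V ip B \<longrightarrow> d = (if finite B then of_nat (card B) else \<infinity>))"

section \<open>Reproducing measure, Wick operators and Wick product\<close>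

text \<open>Local expressions of \<open>K\<close> and \<open>K\<^sup>#\<close>, from the orthonormal basis \<open>B\<close>.\<close>

definition kernel_diag :: "('i, 'x) bsection set \<Rightarrow> 'i \<Rightarrow> 'x \<Rightarrow> real" where
  "kernel_diag B i x = (\<Sum>\<^sub>\<infinity>b\<in>B. (cmod (b i x))\<^sup>2)"

definition kernel :: "('i, 'x) bsection set \<Rightarrow> 'i \<Rightarrow> 'i \<Rightarrow> 'x \<Rightarrow> 'x \<Rightarrow> complex" where
  "kernel B i j x y = (\<Sum>\<^sub>\<infinity>b\<in>B. b i x * cnj (b j y))"

definition reproducing_measure ::
  "real \<Rightarrow> ('x::topological_space, complex ^ 'n::finite) chart set \<Rightarrow> ('x, 'n) two_form \<Rightarrow>
   ('i, 'x) line_bundle \<Rightarrow> 'x measure \<Rightarrow> ('i, 'x) bsection set \<Rightarrow> bool" where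
  "reproducing_measure h A \<omega> E m B \<longleftrightarrow>
     sets m = sets borel \<and>
     (\<forall>C. compact C \<longrightarrow> emeasure m C < \<infinity>) \<and>
     (\<forall>U. open U \<longrightarrow> U \<noteq> {} \<longrightarrow> emeasure m U > 0) \<and>
     (\<forall>i. kahler_potential A \<omega> (patch E i) (\<lambda>x. h * ln (kernel_diag B i x))) \<and>
     (\<forall>i. \<forall>x\<in>patch E i. kernel_diag B i x = exp (pot E i x / h))"

text \<open>
  \<open>\<Psi>\<close> represents \<open>\<psi>\<^sup>#\<close>. Over a compact leaf an everywhere regular \<open>\<psi>\<^sup>#\<close> would be constant, so
  \<open>\<psi>\<^sup>#(x|y)\<close> may be singular where \<open>K\<^sup>#(x|y) = 0\<close> (e.g. at antipodal points of the sphere). In all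
  integrals below \<open>\<psi>\<^sup>#\<close> is multiplied by \<open>K\<^sup>#\<close>, so the values of \<open>\<Psi>\<close> there are immaterial.
\<close>

definition sesqui_extension ::
  "('x, complex ^ 'n::finite) chart set \<Rightarrow> ('i, 'x) line_bundle \<Rightarrow> ('i, 'x) bsection set \<Rightarrow>
   ('x \<Rightarrow> complex) \<Rightarrow> ('x \<Rightarrow> 'x \<Rightarrow> complex) \<Rightarrow> bool" where
  "sesqui_extension A E B \<psi> \<Psi> \<longleftrightarrow>
     (let R = {(x, y). kernel B (triv E x) (triv E y) x y \<noteq> 0} in
      (\<forall>y. antiholomorphic_fun_on A {x. (x, y) \<in> R} (\<lambda>x. \<Psi> x y)) \<and>
      (\<forall>x. holomorphic_fun_on A {y. (x, y) \<in> R} (\<lambda>y. \<Psi> x y)) \<and>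
      (\<forall>x. \<Psi> x x = \<psi> x))"

definition wick_op_integrand ::
  "real \<Rightarrow> ('i, 'x) line_bundle \<Rightarrow> ('i, 'x) bsection set \<Rightarrow> ('x \<Rightarrow> 'x \<Rightarrow> complex) \<Rightarrow>
   ('i, 'x) bsection \<Rightarrow> 'i \<Rightarrow> 'x \<Rightarrow> 'x \<Rightarrow> complex" where
  "wick_op_integrand h E B \<Psi> u i x y =
     (let j = triv E y in
      kernel B i j x y * \<Psi> x y * u j y * of_real (exp (- pot E j y / h)))"

definition wick_op ::
  "real \<Rightarrow> nat \<Rightarrow> ('i, 'x) line_bundle \<Rightarrow> 'x measure \<Rightarrow> ('i, 'x) bsection set \<Rightarrow>
   ('x \<Rightarrow> 'x \<Rightarrow> complex) \<Rightarrow> ('i, 'x) bsection \<Rightarrow> ('i, 'x) bsection" where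
  "wick_op h n E m B \<Psi> u i x =
     (if x \<in> patch E i
      then of_real (1 / (2 * pi * h) ^ n) * (LINT y|m. wick_op_integrand h E B \<Psi> u i x y)
      else 0)"

definition wick_prod_integrand ::
  "('i, 'x) line_bundle \<Rightarrow> ('i, 'x) bsection set \<Rightarrow> ('x \<Rightarrow> 'x \<Rightarrow> complex) \<Rightarrow>
   ('x \<Rightarrow> 'x \<Rightarrow> complex) \<Rightarrow> 'x \<Rightarrow> 'x \<Rightarrow> complex" where
  "wick_prod_integrand E B \<Psi> X x y =
     (let i = triv E x; j = triv E y in
      of_real ((cmod (kernel B i j x y))\<^sup>2 / (kernel_diag B i x * kernel_diag B j y)) *
        \<Psi> x y * X y x)"

definition wick_prod ::
  "real \<Rightarrow> nat \<Rightarrow> ('i, 'x) line_bundle \<Rightarrow> 'x measure \<Rightarrow> ('i, 'x) bsection set \<Rightarrow>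
   ('x \<Rightarrow> 'x \<Rightarrow> complex) \<Rightarrow> ('x \<Rightarrow> 'x \<Rightarrow> complex) \<Rightarrow> 'x \<Rightarrow> complex" where
  "wick_prod h n E m B \<Psi> X x =
     of_real (1 / (2 * pi * h) ^ n) * (LINT y|m. wick_prod_integrand E B \<Psi> X x y)"

text \<open>
  The identity \<open>f| * g| = (f \<star> g)|\<close>, for the restriction map \<open>r\<close>. It includes that \<open>r f\<close> has an
  extension and that the integrals converge.
\<close>

definition restriction_multiplicative ::
  "real \<Rightarrow> nat \<Rightarrow> ('x, complex ^ 'n::finite) chart set \<Rightarrow> ('i, 'x) line_bundle \<Rightarrow> 'x measure \<Rightarrow>
   ('i, 'x) bsection set \<Rightarrow> ('m \<Rightarrow> complex) set \<Rightarrow>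
   (('m \<Rightarrow> complex) \<Rightarrow> ('m \<Rightarrow> complex) \<Rightarrow> ('m \<Rightarrow> complex)) \<Rightarrow>
   (('m \<Rightarrow> complex) \<Rightarrow> ('x \<Rightarrow> complex)) \<Rightarrow> bool" where
  "restriction_multiplicative h n A E m B F st r \<longleftrightarrow>
     (\<forall>f\<in>F. \<exists>\<Psi>. sesqui_extension A E B (r f) \<Psi>) \<and>
     (\<forall>f\<in>F. \<forall>g\<in>F. \<forall>\<Psi> X. sesqui_extension A E B (r f) \<Psi> \<longrightarrow> sesqui_extension A E B (r g) X \<longrightarrow>
        (\<forall>x. integrable m (wick_prod_integrand E B \<Psi> X x) \<and>
             wick_prod h n E m B \<Psi> X x = r (st f g) x))"

text \<open>The Wick operator is an everywhere defined operator on the sections, and has a trace.\<close>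

definition wick_op_has_trace ::
  "real \<Rightarrow> nat \<Rightarrow> ('x, complex ^ 'n::finite) chart set \<Rightarrow> ('i, 'x) line_bundle \<Rightarrow> 'x measure \<Rightarrow>
   ('i, 'x) bsection set \<Rightarrow> ('x \<Rightarrow> 'x \<Rightarrow> complex) \<Rightarrow> bool" where
  "wick_op_has_trace h n A E m B \<Psi> \<longleftrightarrow>
     (\<forall>u\<in>section_space h A E m. \<forall>i. \<forall>x\<in>patch E i.
        integrable m (wick_op_integrand h E B \<Psi> u i x)) \<and>
     trace_class (section_space h A E m) (section_ip h n E m) (wick_op h n E m B \<Psi>)"

end

theory Submission
  imports Defs
begin

text \<open>
  Write \<open>C = 1 / (2 \<pi> h)^n\<close>, \<open>T\<close> for the Wick operator of \<open>\<psi> = f|\<close>, and \<open>|u(x)|\<close> for the norm of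
  \<open>u(x)\<close> in the fiber at \<open>x\<close>. Both formulas integrate a pointwise identity over the leaf.

  The normalization \<open>K = exp (F / h)\<close> says that \<open>\<Sum>b\<in>B. |b(x)|\<^sup>2 = 1\<close> at every \<open>x\<close>. Integrating it
  counts the members of \<open>B\<close>, which is the dimension formula (\<open>dimension_formula\<close>). It also bounds
  \<open>|u(x)|\<close> by \<open>\<parallel>u\<parallel>\<close>, first on the span of \<open>B\<close> and then, by continuity of sections and positivity of
  the measure on open sets, on the whole space (\<open>pnorm_le_ip_norm\<close>). Hence evaluation at \<open>x\<close> is
  represented by a section \<open>g\<close>, the coherent section at \<open>x\<close>, whose local expression is the
  reproducing kernel (\<open>coherent_section\<close>).

  The value of \<open>T g\<close> at \<open>x\<close> is \<open>K(x)\<close> times the Wick product \<open>\<psi> * 1\<close> at \<open>x\<close> (\<open>wick_op_coherent\<close>).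
  As \<open>1\<close> restricts to \<open>1\<close>, multiplicativity of the restriction yields \<open>\<psi> * 1 = (f \<star> 1)| = \<psi>\<close>, so
  \<open>\<psi>(x) = (T g)(x) / K(x)\<close>. If now \<open>T = \<Sum>k. \<langle>\<cdot>, c k\<rangle> a k\<close> is a nuclear decomposition, the reproducing
  property turns this into \<open>\<psi>(x) = \<Sum>k. (a k, c k)(x)\<close>, a series of fiber forms. It converges in
  \<open>L\<^sup>1\<close> by the Cauchy--Schwarz inequality, and integrating it termwise gives
  \<open>C \<integral> \<psi> dm = \<Sum>k. \<langle>a k, c k\<rangle>\<close>, which is the trace of \<open>T\<close> in every orthonormal basis
  (\<open>trace_formula\<close>, \<open>trace_nuclear\<close>).
\<close>

section \<open>Hilbert spaces of sections\<close>

locale section_hilbert_space =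
  fixes V :: "('i, 'x) bsection set" and ip :: "('i, 'x) inner_product"
  assumes hilbert: "hilbert_space V ip"
begin

lemma zero_mem: "(\<lambda>_ _. 0) \<in> V"
  and comb_mem: "u \<in> V \<Longrightarrow> v \<in> V \<Longrightarrow> (\<lambda>i x. a * u i x + v i x) \<in> V"
  and ip_cnj: "u \<in> V \<Longrightarrow> v \<in> V \<Longrightarrow> ip v u = cnj (ip u v)"
  and ip_comb_left: "u \<in> V \<Longrightarrow> v \<in> V \<Longrightarrow> w \<in> V \<Longrightarrow>
        ip (\<lambda>i x. a * u i x + v i x) w = a * ip u w + ip v w"
  and ip_nonneg: "u \<in> V \<Longrightarrow> Re (ip u u) \<ge> 0"
  and ip_eq_zeroD: "u \<in> V \<Longrightarrow> ip u u = 0 \<Longrightarrow> u = (\<lambda>_ _. 0)"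
  and complete: "(\<And>k::nat. s k \<in> V) \<Longrightarrow>
        (\<And>\<epsilon>. \<epsilon> > 0 \<Longrightarrow> \<exists>N. \<forall>k\<ge>N. \<forall>l\<ge>N. ip_dist ip (s k) (s l) < \<epsilon>) \<Longrightarrow>
        \<exists>u\<in>V. (\<lambda>k. ip_dist ip (s k) u) \<longlonglongrightarrow> 0"
  using hilbert unfolding hilbert_space_def by blast+

lemma ip_zero_left: "w \<in> V \<Longrightarrow> ip (\<lambda>_ _. 0) w = 0"
  using ip_comb_left[OF zero_mem zero_mem, of w 1] by simp

lemma diff_mem: "u \<in> V \<Longrightarrow> v \<in> V \<Longrightarrow> (\<lambda>i x. u i x - v i x) \<in> V"
  using comb_mem[of v u "-1"] by simp

lemma ip_diff_left:
  "u \<in> V \<Longrightarrow> v \<in> V \<Longrightarrow> w \<in> V \<Longrightarrow> ip (\<lambda>i x. u i x - v i x) w = ip u w - ip v w"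
  using ip_comb_left[of v u w "-1"] by simp

lemma sum_mem:
  assumes "finite S" "\<And>k. k \<in> S \<Longrightarrow> f k \<in> V"
  shows "(\<lambda>i x. \<Sum>k\<in>S. a k * f k i x) \<in> V"
  using assms by (induction S) (auto intro: zero_mem comb_mem)

lemma ip_sum_left:
  assumes "finite S" "\<And>k. k \<in> S \<Longrightarrow> f k \<in> V" "w \<in> V"
  shows "ip (\<lambda>i x. \<Sum>k\<in>S. a k * f k i x) w = (\<Sum>k\<in>S. a k * ip (f k) w)"
  using assms by (induction S) (auto simp: ip_zero_left ip_comb_left sum_mem)

lemma ip_sum_right:
  assumes "finite S" "\<And>k. k \<in> S \<Longrightarrow> f k \<in> V" "w \<in> V"
  shows "ip w (\<lambda>i x. \<Sum>k\<in>S. a k * f k i x) = (\<Sum>k\<in>S. cnj (a k) * ip w (f k))"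
proof -
  have "ip w (\<lambda>i x. \<Sum>k\<in>S. a k * f k i x) = cnj (\<Sum>k\<in>S. a k * ip (f k) w)"
    using ip_cnj[OF sum_mem[where f = f and a = a, OF assms(1,2)] assms(3)]
      ip_sum_left[where f = f and a = a, OF assms] by simp
  also have "\<dots> = (\<Sum>k\<in>S. cnj (a k) * ip w (f k))"
    using ip_cnj[OF assms(2) assms(3)] by simp
  finally show ?thesis .
qed

lemma ip_diff_right:
  "u \<in> V \<Longrightarrow> v \<in> V \<Longrightarrow> w \<in> V \<Longrightarrow> ip w (\<lambda>i x. u i x - v i x) = ip w u - ip w v"
  using ip_cnj[of "\<lambda>i x. u i x - v i x" w] ip_cnj[of u w] ip_cnj[of v w]
  by (simp add: ip_diff_left diff_mem)

lemma ip_norm_nonneg: "u \<in> V \<Longrightarrow> ip_norm ip u \<ge> 0"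
  by (simp add: ip_norm_def ip_nonneg)

lemma ip_self: "u \<in> V \<Longrightarrow> ip u u = of_real ((ip_norm ip u)\<^sup>2)"
  using arg_cong[OF ip_cnj[of u u], of Im] by (simp add: ip_norm_def ip_nonneg complex_eq_iff)

lemma ip_norm_eq_zeroD: "u \<in> V \<Longrightarrow> ip_norm ip u = 0 \<Longrightarrow> u = (\<lambda>_ _. 0)"
  using ip_self[of u] ip_eq_zeroD by simp

lemma Cauchy_Schwarz:
  assumes u: "u \<in> V" and v: "v \<in> V"
  shows "cmod (ip u v) \<le> ip_norm ip u * ip_norm ip v"
proof (cases "ip_norm ip u = 0")
  case True
  then show ?thesis using ip_norm_eq_zeroD[OF u] ip_zero_left[OF v] by simp
next
  case False
  define r where "r = (ip_norm ip u)\<^sup>2"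
  have r: "r > 0" "ip u u = of_real r" using False ip_self[OF u] by (auto simp: r_def)
  define a where "a = - cnj (ip u v) / of_real r"
  define w where "w = (\<lambda>i x. a * u i x + v i x)"
  have wV: "w \<in> V" unfolding w_def using u v by (rule comb_mem)
  have wu: "ip w u = 0"
    using ip_comb_left[OF u v u, of a] r ip_cnj[OF u v] by (simp add: w_def a_def)
  have "ip w w = a * ip u w + ip v w"
    unfolding w_def by (rule ip_comb_left[OF u v]) (use wV in \<open>simp add: w_def\<close>)
  also have "\<dots> = cnj (ip w v)"
    using wu ip_cnj[OF wV u] ip_cnj[OF wV v] by simp
  also have "ip w v = a * ip u v + ip v v"
    using ip_comb_left[OF u v v] by (simp add: w_def)
  also have "\<dots> = of_real ((ip_norm ip v)\<^sup>2 - (cmod (ip u v))\<^sup>2 / r)"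
    using complex_norm_square[of "ip u v"] ip_self[OF v] by (simp add: a_def mult.commute)
  finally have "0 \<le> (ip_norm ip v)\<^sup>2 - (cmod (ip u v))\<^sup>2 / r"
    using ip_nonneg[OF wV] by simp
  then have "(cmod (ip u v))\<^sup>2 \<le> (ip_norm ip u * ip_norm ip v)\<^sup>2"
    using r(1) by (simp add: field_simps r_def)
  then show ?thesis
    using power2_le_imp_le ip_norm_nonneg[OF u] ip_norm_nonneg[OF v] by simp
qed

lemma ip_norm_diff_sq:
  assumes u: "u \<in> V" and v: "v \<in> V"
  shows "(ip_norm ip (\<lambda>i x. u i x - v i x))\<^sup>2 =
     (ip_norm ip u)\<^sup>2 + (ip_norm ip v)\<^sup>2 - 2 * Re (ip u v)"
proof -
  have "of_real ((ip_norm ip (\<lambda>i x. u i x - v i x))\<^sup>2) = ip u u - ip u v - (ip v u - ip v v)"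
    using ip_self[OF diff_mem[OF u v]]
    by (simp add: ip_diff_left ip_diff_right diff_mem u v algebra_simps)
  then have "(ip_norm ip (\<lambda>i x. u i x - v i x))\<^sup>2 = Re (ip u u - ip u v - (ip v u - ip v v))"
    by (metis Re_complex_of_real)
  then show ?thesis
    using ip_cnj[OF u v] by (simp add: ip_self[OF u] ip_self[OF v])
qed

lemma cmod_ip_commute: "u \<in> V \<Longrightarrow> v \<in> V \<Longrightarrow> cmod (ip u v) = cmod (ip v u)"
  by (metis complex_mod_cnj ip_cnj)

lemma ip_dist_nonneg: "u \<in> V \<Longrightarrow> v \<in> V \<Longrightarrow> ip_dist ip u v \<ge> 0"
  unfolding ip_dist_def by (rule ip_norm_nonneg[OF diff_mem])

lemma ip_dist_commute:
  assumes "u \<in> V" "v \<in> V"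
  shows "ip_dist ip u v = ip_dist ip v u"
proof (rule power2_eq_imp_eq)
  show "(ip_dist ip u v)\<^sup>2 = (ip_dist ip v u)\<^sup>2"
    using assms by (simp add: ip_dist_def ip_norm_diff_sq ip_cnj[of u v])
qed (use assms ip_dist_nonneg in auto)

lemma ip_norm_diff_le:
  assumes u: "u \<in> V" and v: "v \<in> V"
  shows "ip_norm ip (\<lambda>i x. u i x - v i x) \<le> ip_norm ip u + ip_norm ip v"
proof (rule power2_le_imp_le)
  have "- Re (ip u v) \<le> ip_norm ip u * ip_norm ip v"
    using Cauchy_Schwarz[OF u v] abs_Re_le_cmod[of "ip u v"] by linarith
  then show "(ip_norm ip (\<lambda>i x. u i x - v i x))\<^sup>2 \<le> (ip_norm ip u + ip_norm ip v)\<^sup>2"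
    by (simp add: ip_norm_diff_sq[OF u v] power2_sum)
qed (use ip_norm_nonneg u v in auto)

lemma ip_tendsto:
  assumes "\<And>k. s k \<in> V" "u \<in> V" "w \<in> V" and lim: "((\<lambda>k. ip_dist ip (s k) u) \<longlongrightarrow> 0) G"
  shows "((\<lambda>k. ip (s k) w) \<longlongrightarrow> ip u w) G"
proof (rule Lim_null[THEN iffD2], rule Lim_null_comparison)
  show "\<forall>\<^sub>F k in G. norm (ip (s k) w - ip u w) \<le> ip_dist ip (s k) u * ip_norm ip w"
    using Cauchy_Schwarz[OF diff_mem[OF assms(1,2)] assms(3)] ip_diff_left[OF assms(1-3)]
    by (simp add: ip_dist_def)
  show "((\<lambda>k. ip_dist ip (s k) u * ip_norm ip w) \<longlongrightarrow> 0) G"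
    using tendsto_mult_left_zero[OF lim] .
qed

end

section \<open>Orthonormal bases\<close>

locale section_hilbert_basis = section_hilbert_space V ip
  for V :: "('i, 'x) bsection set" and ip :: "('i, 'x) inner_product" +
  fixes B :: "('i, 'x) bsection set"
  assumes basis: "orthonormal_basis V ip B"
begin

lemma basis_mem: "b \<in> B \<Longrightarrow> b \<in> V"
  and basis_ip: "b \<in> B \<Longrightarrow> b' \<in> B \<Longrightarrow> ip b b' = (if b = b' then 1 else 0)"
  and basis_dense: "u \<in> V \<Longrightarrow> \<epsilon> > 0 \<Longrightarrow>
     \<exists>S a. finite S \<and> S \<subseteq> B \<and> ip_dist ip u (\<lambda>i x. \<Sum>b\<in>S. a b * b i x) < \<epsilon>"
  using basis unfolding orthonormal_basis_def by auto

lemma basis_sum_mem: "finite S \<Longrightarrow> S \<subseteq> B \<Longrightarrow> (\<lambda>i x. \<Sum>b\<in>S. a b * b i x) \<in> V"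
  by (rule sum_mem) (auto intro: basis_mem)

lemma basis_sum_norm:
  assumes "finite S" "S \<subseteq> B"
  shows "(ip_norm ip (\<lambda>i x. \<Sum>b\<in>S. a b * b i x))\<^sup>2 = (\<Sum>b\<in>S. (cmod (a b))\<^sup>2)"
proof -
  let ?w = "\<lambda>i x. \<Sum>b\<in>S. a b * b i x"
  have "ip b ?w = cnj (a b)" if "b \<in> S" for b
  proof -
    have "ip b ?w = (\<Sum>b'\<in>S. cnj (a b') * ip b b')"
      using assms that by (intro ip_sum_right) (auto intro: basis_mem)
    also have "\<dots> = (\<Sum>b'\<in>S. if b = b' then cnj (a b') else 0)"
      using assms that by (intro sum.cong) (auto simp: basis_ip subset_iff)
    finally show ?thesis using assms that by simp
  qed
  then have "(\<Sum>b\<in>S. a b * ip b ?w) = (\<Sum>b\<in>S. complex_of_real ((cmod (a b))\<^sup>2))"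
    by (intro sum.cong refl) (simp only: complex_norm_square)
  moreover have "ip ?w ?w = (\<Sum>b\<in>S. a b * ip b ?w)"
    using assms by (intro ip_sum_left basis_sum_mem) (auto intro: basis_mem)
  ultimately have "of_real ((ip_norm ip ?w)\<^sup>2) = (\<Sum>b\<in>S. complex_of_real ((cmod (a b))\<^sup>2))"
    by (simp only: ip_self[OF basis_sum_mem[OF assms]])
  then show ?thesis
    by (simp only: of_real_sum[symmetric] of_real_eq_iff)
qed

text \<open>
  Completing the square: among all combinations of the members of \<open>S\<close>, the one with the Fourier
  coefficients of \<open>u\<close> is nearest to \<open>u\<close>.
\<close>

lemma dist_basis_sum:
  assumes u: "u \<in> V" and S: "finite S" "S \<subseteq> B"
  shows "(ip_dist ip u (\<lambda>i x. \<Sum>b\<in>S. a b * b i x))\<^sup>2 =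
    (ip_norm ip u)\<^sup>2 - (\<Sum>b\<in>S. (cmod (ip u b))\<^sup>2) + (\<Sum>b\<in>S. (cmod (a b - ip u b))\<^sup>2)"
proof -
  have "(ip_dist ip u (\<lambda>i x. \<Sum>b\<in>S. a b * b i x))\<^sup>2 =
      (ip_norm ip u)\<^sup>2 + (\<Sum>b\<in>S. (cmod (a b))\<^sup>2) - 2 * (\<Sum>b\<in>S. Re (cnj (a b) * ip u b))"
    using S u ip_sum_right[of S "\<lambda>b. b" u a]
    by (simp add: ip_dist_def ip_norm_diff_sq basis_sum_mem basis_sum_norm basis_mem subset_iff)
  also have "\<dots> = (ip_norm ip u)\<^sup>2 +
      (\<Sum>b\<in>S. (cmod (a b))\<^sup>2 - 2 * Re (cnj (a b) * ip u b))"
    by (simp add: sum_subtractf sum_distrib_left)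
  also have "(\<Sum>b\<in>S. (cmod (a b))\<^sup>2 - 2 * Re (cnj (a b) * ip u b)) =
      (\<Sum>b\<in>S. (cmod (a b - ip u b))\<^sup>2 - (cmod (ip u b))\<^sup>2)"
    unfolding cmod_power2 by (intro sum.cong refl) (simp add: power2_eq_square algebra_simps)
  finally show ?thesis by (simp add: sum_subtractf)
qed

lemma Bessel:
  assumes "u \<in> V" "finite S" "S \<subseteq> B"
  shows "(\<Sum>b\<in>S. (cmod (ip u b))\<^sup>2) \<le> (ip_norm ip u)\<^sup>2"
  using dist_basis_sum[OF assms, of "ip u"] 
    zero_le_power2[of "ip_dist ip u (\<lambda>i x. \<Sum>b\<in>S. ip u b * b i x)"] by simp

lemma Fourier_tendsto:
  assumes u: "u \<in> V"
  shows "((\<lambda>S. ip_dist ip (\<lambda>i x. \<Sum>b\<in>S. ip u b * b i x) u) \<longlongrightarrow> 0) (finite_subsets_at_top B)"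
proof (rule tendstoI)
  fix \<epsilon> :: real assume e: "\<epsilon> > 0"
  obtain S0 a where S0: "finite S0" "S0 \<subseteq> B"
    and d: "ip_dist ip u (\<lambda>i x. \<Sum>b\<in>S0. a b * b i x) < \<epsilon>"
    using basis_dense[OF u e] by blast
  show "\<forall>\<^sub>F S in finite_subsets_at_top B.
      dist (ip_dist ip (\<lambda>i x. \<Sum>b\<in>S. ip u b * b i x) u) 0 < \<epsilon>"
    unfolding eventually_finite_subsets_at_top
  proof (intro exI[of _ S0] conjI allI impI S0)
    fix S assume S: "finite S \<and> S0 \<subseteq> S \<and> S \<subseteq> B"
    let ?w = "\<lambda>i x. \<Sum>b\<in>S. ip u b * b i x"
    have w: "?w \<in> V" using S by (intro basis_sum_mem) auto
    have "(ip_dist ip ?w u)\<^sup>2 = (ip_dist ip u ?w)\<^sup>2"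
      using ip_dist_commute[OF w u] by simp
    also have "\<dots> = (ip_norm ip u)\<^sup>2 - (\<Sum>b\<in>S. (cmod (ip u b))\<^sup>2)"
      using S by (subst dist_basis_sum[OF u]) auto
    also have "\<dots> \<le> (ip_norm ip u)\<^sup>2 - (\<Sum>b\<in>S0. (cmod (ip u b))\<^sup>2)"
      using S by (intro diff_left_mono sum_mono2) auto
    also have "\<dots> \<le> (ip_dist ip u (\<lambda>i x. \<Sum>b\<in>S0. a b * b i x))\<^sup>2"
      unfolding dist_basis_sum[OF u S0] using sum_nonneg[of S0 "\<lambda>b. (cmod (a b - ip u b))\<^sup>2"] by force
    finally have "(ip_dist ip ?w u)\<^sup>2 \<le> (ip_dist ip u (\<lambda>i x. \<Sum>b\<in>S0. a b * b i x))\<^sup>2" .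
    then have "ip_dist ip ?w u \<le> ip_dist ip u (\<lambda>i x. \<Sum>b\<in>S0. a b * b i x)"
      by (rule power2_le_imp_le)
         (use ip_norm_nonneg[OF diff_mem[OF u basis_sum_mem[OF S0, of a]]] in \<open>simp add: ip_dist_def\<close>)
    then show "dist (ip_dist ip ?w u) 0 < \<epsilon>"
      using d ip_norm_nonneg[OF diff_mem[OF w u]] by (simp add: ip_dist_def)
  qed
qed

lemma eventually_basis_sum_mem:
  "\<forall>\<^sub>F S in finite_subsets_at_top B. finite S \<and> S \<subseteq> B"
  by (rule eventually_finite_subsets_at_top_weakI) auto

lemma Parseval:
  assumes u: "u \<in> V" and v: "v \<in> V"
  shows "((\<lambda>b. ip u b * ip b v) has_sum ip u v) B"
  unfolding has_sum_def
proof (rule Lim_transform_eventually)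
  \<comment> \<open>The filter only eventually consists of finite subsets of the basis; the value \<open>0\<close> elsewhere
    keeps the family inside the space.\<close>
  let ?s = "\<lambda>S. if finite S \<and> S \<subseteq> B then (\<lambda>i x. \<Sum>b\<in>S. ip u b * b i x) else (\<lambda>_ _. 0)"
  have "((\<lambda>S. ip_dist ip (?s S) u) \<longlongrightarrow> 0) (finite_subsets_at_top B)"
    by (rule Lim_transform_eventually[OF Fourier_tendsto[OF u]])
       (use eventually_basis_sum_mem in \<open>eventually_elim, simp\<close>)
  then show "((\<lambda>S. ip (?s S) v) \<longlongrightarrow> ip u v) (finite_subsets_at_top B)"
    by (intro ip_tendsto[OF _ u v]) (auto intro: zero_mem basis_sum_mem)
  show "\<forall>\<^sub>F S in finite_subsets_at_top B. ip (?s S) v = (\<Sum>b\<in>S. ip u b * ip b v)"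
    using eventually_basis_sum_mem
    by eventually_elim (use v in \<open>auto intro!: ip_sum_left basis_mem\<close>)
qed

lemma Parseval_norm:
  assumes u: "u \<in> V"
  shows "((\<lambda>b. (cmod (ip u b))\<^sup>2) has_sum (ip_norm ip u)\<^sup>2) B"
proof -
  have "((\<lambda>b. complex_of_real ((cmod (ip u b))\<^sup>2)) has_sum of_real ((ip_norm ip u)\<^sup>2)) B"
    using Parseval[OF u u] unfolding ip_self[OF u]
    by (rule has_sum_cong[THEN iffD1, rotated])
       (simp only: ip_cnj[OF u basis_mem] complex_norm_square)
  from has_sum_Re[OF this] show ?thesis by simp
qed

text \<open>
  Riesz--Fischer. The limit is taken along a sequence of finite sets, since completeness concerns
  sequences while \<open>B\<close> need not be countable.
\<close>

lemma Riesz_Fischer: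
  assumes "(\<lambda>b. (cmod (\<alpha> b))\<^sup>2) summable_on B"
  shows "\<exists>g\<in>V. \<forall>b\<in>B. ip g b = \<alpha> b"
proof -
  let ?q = "\<lambda>b. (cmod (\<alpha> b))\<^sup>2"
  define t where "t = infsum ?q B"
  have "(?q has_sum t) B" unfolding t_def using assms by simp
  then have T: "((\<lambda>S. sum ?q S) \<longlongrightarrow> t) (finite_subsets_at_top B)"
    by (simp add: has_sum_def)
  have "\<exists>S. finite S \<and> S \<subseteq> B \<and> (\<forall>S'. finite S' \<longrightarrow> S \<subseteq> S' \<longrightarrow> S' \<subseteq> B \<longrightarrow>
      dist (sum ?q S') t < 1 / real (Suc k))" for k
  proof -
    have "\<forall>\<^sub>F S in finite_subsets_at_top B. dist (sum ?q S) t < 1 / real (Suc k)"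
      by (rule tendstoD[OF T]) simp
    then show ?thesis unfolding eventually_finite_subsets_at_top by meson
  qed
  then obtain S where S: "\<And>k. finite (S k)" "\<And>k. S k \<subseteq> B"
    and close: "\<And>k S'. finite S' \<Longrightarrow> S k \<subseteq> S' \<Longrightarrow> S' \<subseteq> B \<Longrightarrow>
      dist (sum ?q S') t < 1 / real (Suc k)"
    by metis
  have tail: "sum ?q D < 2 / real (Suc k)" if "finite D" "D \<subseteq> B" "D \<inter> S k = {}" for D k
  proof -
    have "dist (sum ?q (S k \<union> D)) t < 1 / real (Suc k)" "dist (sum ?q (S k)) t < 1 / real (Suc k)"
      by (intro close; use that S in blast)+
    moreover have "sum ?q (S k \<union> D) = sum ?q (S k) + sum ?q D"
      using that S by (intro sum.union_disjoint) auto
    ultimately show ?thesis by (simp add: dist_real_def abs_if split: if_splits)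
  qed
  define s where "s k = (\<lambda>i x. \<Sum>b\<in>S k. \<alpha> b * b i x)" for k
  have sV: "s k \<in> V" for k unfolding s_def by (rule basis_sum_mem[OF S])
  have sdist: "(ip_dist ip (s k) (s l))\<^sup>2 < 2 / real (Suc k) + 2 / real (Suc l)" for k l
  proof -
    let ?a = "\<lambda>b. (if b \<in> S k then \<alpha> b else 0) - (if b \<in> S l then \<alpha> b else 0)"
    have "(\<lambda>i x. s k i x - s l i x) = (\<lambda>i x. \<Sum>b\<in>S k \<union> S l. ?a b * b i x)"
    proof (intro ext)
      fix i x
      have "s k i x = (\<Sum>b\<in>S k \<union> S l. (if b \<in> S k then \<alpha> b else 0) * b i x)"
        unfolding s_def using S by (intro sum.mono_neutral_cong_left) auto
      moreover have "s l i x = (\<Sum>b\<in>S k \<union> S l. (if b \<in> S l then \<alpha> b else 0) * b i x)"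
        unfolding s_def using S by (intro sum.mono_neutral_cong_left) auto
      ultimately show "s k i x - s l i x = (\<Sum>b\<in>S k \<union> S l. ?a b * b i x)"
        by (simp add: sum_subtractf left_diff_distrib)
    qed
    then have "(ip_dist ip (s k) (s l))\<^sup>2 = (\<Sum>b\<in>S k \<union> S l. (cmod (?a b))\<^sup>2)"
      using S by (simp add: ip_dist_def basis_sum_norm)
    also have "\<dots> = (\<Sum>b\<in>(S l - S k) \<union> (S k - S l). ?q b)"
      using S by (intro sum.mono_neutral_cong_right) auto
    also have "\<dots> = sum ?q (S l - S k) + sum ?q (S k - S l)"
      using S by (intro sum.union_disjoint) auto
    also have "\<dots> < 2 / real (Suc k) + 2 / real (Suc l)"
      using S by (intro add_strict_mono tail) auto
    finally show ?thesis .
  qed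
  have "\<exists>N. \<forall>k\<ge>N. \<forall>l\<ge>N. ip_dist ip (s k) (s l) < \<epsilon>" if e: "\<epsilon> > 0" for \<epsilon>
  proof -
    obtain N where N: "4 / \<epsilon>\<^sup>2 < real N" using reals_Archimedean2 by blast
    have "ip_dist ip (s k) (s l) < \<epsilon>" if "k \<ge> N" "l \<ge> N" for k l
    proof (rule power2_less_imp_less)
      have "2 / real (Suc j) \<le> \<epsilon>\<^sup>2 / 2" if "j \<ge> N" for j
      proof -
        have "4 / \<epsilon>\<^sup>2 \<le> real (Suc j)" using N that by linarith
        then show ?thesis using e by (simp add: field_simps)
      qed
      from this[OF that(1)] this[OF that(2)] show "(ip_dist ip (s k) (s l))\<^sup>2 < \<epsilon>\<^sup>2"
        using sdist[of k l] by linarith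
    qed (use e in simp)
    then show ?thesis by blast
  qed
  from complete[OF sV this] obtain g where g: "g \<in> V" and lim: "(\<lambda>k. ip_dist ip (s k) g) \<longlonglongrightarrow> 0"
    by blast
  have "ip g b = \<alpha> b" if b: "b \<in> B" for b
  proof (rule LIMSEQ_unique)
    show "(\<lambda>k. ip (s k) b) \<longlonglongrightarrow> ip g b"
      using ip_tendsto[OF sV g basis_mem[OF b] lim] .
    have ev: "ip (s k) b = (if b \<in> S k then \<alpha> b else 0)" for k
    proof -
      have "ip (s k) b = (\<Sum>b'\<in>S k. \<alpha> b' * ip b' b)"
        unfolding s_def using S b by (intro ip_sum_left) (auto intro: basis_mem)
      also have "\<dots> = (\<Sum>b'\<in>S k. if b' = b then \<alpha> b' else 0)"
        using S b by (intro sum.cong) (auto simp: basis_ip subset_iff)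
      finally show ?thesis using S by simp
    qed
    have bound: "(cmod (ip (s k) b - \<alpha> b))\<^sup>2 \<le> 2 / real (Suc k)" for k
      using tail[of "{b}" k] b by (auto simp: ev intro: less_imp_le)
    have "(\<lambda>k. (cmod (ip (s k) b - \<alpha> b))\<^sup>2) \<longlonglongrightarrow> 0"
    proof (rule Lim_null_comparison)
      show "\<forall>\<^sub>F k in sequentially. norm ((cmod (ip (s k) b - \<alpha> b))\<^sup>2) \<le> 2 * inverse (real (Suc k))"
        using bound by (simp add: divide_inverse)
      show "(\<lambda>k. 2 * inverse (real (Suc k))) \<longlonglongrightarrow> 0"
        using tendsto_mult_right_zero[OF LIMSEQ_inverse_real_of_nat] .
    qed
    then have "(\<lambda>k. sqrt ((cmod (ip (s k) b - \<alpha> b))\<^sup>2)) \<longlonglongrightarrow> sqrt 0"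
      by (rule tendsto_real_sqrt)
    then show "(\<lambda>k. ip (s k) b) \<longlonglongrightarrow> \<alpha> b"
      by (simp add: Lim_null[of _ "\<alpha> b"] tendsto_norm_zero_iff)
  qed
  with g show ?thesis by blast
qed

section \<open>Trace and dimension do not depend on the basis\<close>

text \<open>
  Parseval's identity expands each \<open>\<langle>a k, c k\<rangle>\<close> in the basis, and the sums over \<open>k\<close> and \<open>b\<close> may be
  exchanged since they converge absolutely:
  \<open>\<Sum>b. |\<langle>a, b\<rangle>\<langle>b, c\<rangle>| \<le> \<parallel>a\<parallel> \<parallel>c\<parallel>\<close>.
\<close>

lemma trace_nuclear:
  assumes T: "\<And>u. u \<in> V \<Longrightarrow> T u \<in> V"
    and a: "\<And>k::nat. a k \<in> V" and c: "\<And>k. c k \<in> V"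
    and summ: "summable (\<lambda>k. ip_norm ip (a k) * ip_norm ip (c k))"
    and lim: "\<And>u. u \<in> V \<Longrightarrow>
       (\<lambda>N. ip_dist ip (T u) (\<lambda>i x. \<Sum>k<N. ip u (c k) * a k i x)) \<longlonglongrightarrow> 0"
  shows "((\<lambda>b. ip (T b) b) has_sum (\<Sum>k. ip (a k) (c k))) B"
proof -
  define G where "G k b = ip (a k) b * ip b (c k)" for k b
  have Gsum: "(G k has_sum ip (a k) (c k)) B" for k
    unfolding G_def by (rule Parseval[OF a c])
  have fin: "(\<Sum>b\<in>S. norm (G k b)) \<le> ip_norm ip (a k) * ip_norm ip (c k)"
    if S: "finite S" "S \<subseteq> B" for k S
  proof -
    have "(\<Sum>b\<in>S. norm (G k b)) = (\<Sum>b\<in>S. cmod (ip (a k) b) * cmod (ip (c k) b))"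
      unfolding G_def norm_mult
      using S a c by (intro sum.cong refl) (auto simp: cmod_ip_commute[of _ "c k"] basis_mem subset_iff)
    also have "\<dots> \<le> L2_set (\<lambda>b. cmod (ip (a k) b)) S * L2_set (\<lambda>b. cmod (ip (c k) b)) S"
      using L2_set_mult_ineq[of "\<lambda>b. cmod (ip (a k) b)" "\<lambda>b. cmod (ip (c k) b)" S] by simp
    also have "\<dots> \<le> ip_norm ip (a k) * ip_norm ip (c k)"
      unfolding L2_set_def using Bessel[OF a S] Bessel[OF c S] ip_norm_nonneg[OF a] ip_norm_nonneg[OF c]
      by (intro mult_mono real_le_lsqrt) (auto intro: sum_nonneg)
    finally show ?thesis .
  qed
  have Gabs: "(\<lambda>b. norm (G k b)) summable_on B" for k
    by (rule nonneg_bdd_above_summable_on) (auto intro!: bdd_aboveI2 fin)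
  have Gabs_le: "infsum (\<lambda>b. norm (G k b)) B \<le> ip_norm ip (a k) * ip_norm ip (c k)" for k
    by (rule infsum_le_finite_sums[OF Gabs fin])
  have "(\<lambda>k. infsum (\<lambda>b. norm (G k b)) B) summable_on UNIV"
  proof (rule summable_on_comparison_test)
    show "(\<lambda>k. ip_norm ip (a k) * ip_norm ip (c k)) summable_on UNIV"
      using summ ip_norm_nonneg a c by (intro norm_summable_imp_summable_on) simp
  qed (auto intro!: Gabs_le infsum_nonneg)
  then have all: "(\<lambda>(k, b). norm (G k b)) summable_on UNIV \<times> B"
    using Gabs by (intro summable_on_SigmaI[where g = "\<lambda>k. infsum (\<lambda>b. norm (G k b)) B"]) auto
  have joint: "(\<lambda>(k, b). G k b) summable_on UNIV \<times> B"
    by (rule abs_summable_summable) (use all in \<open>simp add: case_prod_unfold\<close>)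
  have rows: "((\<lambda>k. ip (a k) (c k)) has_sum infsum (\<lambda>(k, b). G k b) (UNIV \<times> B)) UNIV"
    by (rule has_sum_SigmaD[OF has_sum_infsum[OF joint]]) (simp add: Gsum)
  have cols: "((\<lambda>k. G k b) has_sum ip (T b) b) UNIV" if b: "b \<in> B" for b
  proof -
    have "(\<lambda>N. ip (\<lambda>i x. \<Sum>k<N. ip b (c k) * a k i x) b) \<longlonglongrightarrow> ip (T b) b"
    proof (rule ip_tendsto)
      show "(\<lambda>N. ip_dist ip (\<lambda>i x. \<Sum>k<N. ip b (c k) * a k i x) (T b)) \<longlonglongrightarrow> 0"
      proof (rule Lim_transform_eventually[OF lim[OF basis_mem[OF b]]], rule always_eventually, rule allI)
        fix N
        let ?w = "\<lambda>i x. \<Sum>k<N. ip b (c k) * a k i x"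
        have w: "?w \<in> V" and t: "T b \<in> V" using a b by (auto intro: sum_mem T basis_mem)
        show "ip_dist ip (T b) ?w = ip_dist ip ?w (T b)" by (rule ip_dist_commute[OF t w])
      qed
    qed (use a b in \<open>auto intro: sum_mem T basis_mem\<close>)
    moreover have "ip (\<lambda>i x. \<Sum>k<N. ip b (c k) * a k i x) b = (\<Sum>k<N. G k b)" for N
      using a basis_mem[OF b] by (subst ip_sum_left) (auto simp: G_def mult.commute)
    ultimately have "(\<lambda>N. \<Sum>k<N. G k b) \<longlonglongrightarrow> ip (T b) b"
      by (simp only:)
    then have s: "(\<lambda>k. G k b) sums ip (T b) b" by (simp add: sums_def)
    have "(\<lambda>k. norm (G k b)) summable_on UNIV"
    proof -
      have "(\<lambda>(b, k). norm (G k b)) summable_on B \<times> UNIV"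
        using all summable_on_swap[of "\<lambda>(k, b). norm (G k b)" UNIV B] by (simp add: case_prod_unfold)
      from summable_on_SigmaD1[OF this b] show ?thesis by simp
    qed
    then have "summable (\<lambda>k. norm (G k b))"
      by (rule summable_on_imp_summable)
    then show ?thesis by (rule norm_summable_imp_has_sum[OF _ s])
  qed
  have "((\<lambda>(b, k). G k b) has_sum infsum (\<lambda>(k, b). G k b) (UNIV \<times> B)) (B \<times> UNIV)"
    using has_sum_infsum[OF joint] unfolding has_sum_swap[where A = UNIV] by simp
  then have "((\<lambda>b. ip (T b) b) has_sum infsum (\<lambda>(k, b). G k b) (UNIV \<times> B)) B"
    by (rule has_sum_SigmaD) (simp add: cols)
  moreover have "infsum (\<lambda>(k, b). G k b) (UNIV \<times> B) = (\<Sum>k. ip (a k) (c k))"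
    using has_sum_imp_sums[OF rows] by (simp add: sums_iff)
  ultimately show ?thesis by simp
qed

text \<open>
  Summing \<open>|\<langle>b', b\<rangle>|\<^sup>2\<close> over the pairs from \<open>S \<times> B\<close> gives \<open>card S\<close> by Parseval's identity in \<open>B\<close>,
  and at most \<open>card B\<close> by Bessel's inequality in \<open>B'\<close>.
\<close>

lemma card_le_basis:
  assumes B': "orthonormal_basis V ip B'" and fin: "finite B"
  shows "finite B' \<and> card B' \<le> card B"
proof -
  interpret B': section_hilbert_basis V ip B' by unfold_locales (rule B')
  have "card S \<le> card B" if S: "finite S" "S \<subseteq> B'" for S
  proof -
    have unit: "ip_norm ip b = 1" if "b \<in> B' \<or> b \<in> B" for b
      using that B'.basis_ip[of b b] basis_ip[of b b] by (auto simp: ip_norm_def)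
    have "real (card S) = (\<Sum>b'\<in>S. \<Sum>b\<in>B. (cmod (ip b' b))\<^sup>2)"
    proof -
      have "(\<Sum>b\<in>B. (cmod (ip b' b))\<^sup>2) = 1" if "b' \<in> S" for b'
        using Parseval_norm[OF B'.basis_mem, of b'] that S unit[of b'] fin
        by (auto simp: has_sum_finite_iff)
      then show ?thesis by simp
    qed
    also have "\<dots> = (\<Sum>b\<in>B. \<Sum>b'\<in>S. (cmod (ip b b'))\<^sup>2)"
      using S by (subst sum.swap, intro sum.cong refl)
        (auto simp: cmod_ip_commute[OF B'.basis_mem basis_mem] subset_iff)
    also have "\<dots> \<le> (\<Sum>b\<in>B. 1)"
      by (intro sum_mono) (use B'.Bessel[OF basis_mem S] unit in fastforce)
    finally show ?thesis by simp
  qed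
  then show ?thesis
    using finite_if_finite_subsets_card_bdd[of B' "card B"] by blast
qed

lemma hilbert_dim_basis:
  "hilbert_dim V ip = (if finite B then of_nat (card B) else \<infinity>)"
  unfolding hilbert_dim_def
proof (rule the_equality)
  show "\<forall>B'. orthonormal_basis V ip B' \<longrightarrow>
      (if finite B then of_nat (card B) else \<infinity>) = (if finite B' then of_nat (card B') else \<infinity> :: ennreal)"
  proof (intro allI impI)
    fix B' assume B': "orthonormal_basis V ip B'"
    interpret B': section_hilbert_basis V ip B' by unfold_locales (rule B')
    have "finite B \<longleftrightarrow> finite B'" "finite B \<Longrightarrow> card B = card B'"
      using card_le_basis[OF B'] B'.card_le_basis[OF basis] by auto
    then show "(if finite B then of_nat (card B) else \<infinity>) =
        (if finite B' then of_nat (card B') else \<infinity> :: ennreal)" by auto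
  qed
qed (use basis in blast)

end

lemma op_trace_nuclear:
  assumes H: "hilbert_space V ip" and B: "orthonormal_basis V ip B"
    and T: "\<And>u. u \<in> V \<Longrightarrow> T u \<in> V"
    and ac: "\<And>k::nat. a k \<in> V" "\<And>k. c k \<in> V"
    and summ: "summable (\<lambda>k. ip_norm ip (a k) * ip_norm ip (c k))"
    and lim: "\<And>u. u \<in> V \<Longrightarrow>
       (\<lambda>N. ip_dist ip (T u) (\<lambda>i x. \<Sum>k<N. ip u (c k) * a k i x)) \<longlonglongrightarrow> 0"
  shows "op_trace V ip T = (\<Sum>k. ip (a k) (c k))"
proof -
  have tr: "((\<lambda>b. ip (T b) b) has_sum (\<Sum>k. ip (a k) (c k))) B'"
    if B': "orthonormal_basis V ip B'" for B'
  proof -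
    interpret section_hilbert_basis V ip B' by unfold_locales (rule H B')+
    show ?thesis by (rule trace_nuclear[OF T ac summ lim])
  qed
  show ?thesis
    unfolding op_trace_def
    by (rule the_equality) (use tr tr[OF B] B has_sum_unique in blast)+
qed

section \<open>Continuity of functions given in charts\<close>

lemma chart_inverse:
  assumes "is_chart c" "x \<in> fst c"
  shows "inv_chart c (snd c x) = x"
  using assms unfolding is_chart_def homeomorphism_def by blast

lemma continuous_on_from_charts:
  fixes A :: "('x::t2_space, 'e::euclidean_space) chart set"
    and f :: "'x \<Rightarrow> 'b::real_normed_vector"
  assumes "smooth_atlas A" "open W"
    and cont: "\<And>c. c \<in> A \<Longrightarrow> continuous_on (chart_image c W) (f \<circ> inv_chart c)"
  shows "continuous_on W f"
proof (rule continuous_at_imp_continuous_on, rule ballI)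
  fix x assume x: "x \<in> W"
  obtain c where c: "c \<in> A" "x \<in> fst c"
    using assms(1) unfolding smooth_atlas_def by blast
  have chart: "is_chart c" using assms(1) c(1) unfolding smooth_atlas_def by blast
  have "continuous_on (fst c) (snd c)"
    using chart unfolding is_chart_def homeomorphism_def by blast
  then have "continuous_on (fst c \<inter> W) (snd c)" by (rule continuous_on_subset) simp
  then have "continuous_on (fst c \<inter> W) ((f \<circ> inv_chart c) \<circ> snd c)"
    by (rule continuous_on_compose) (use cont[OF c(1)] in \<open>simp only: chart_image_def\<close>)
  then have "continuous_on (fst c \<inter> W) f"
    by (rule continuous_on_eq) (simp add: chart_inverse[OF chart])
  moreover have "open (fst c \<inter> W)"
    using chart assms(2) unfolding is_chart_def by blast
  ultimately show "isCont f x"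
    using x c(2) by (simp add: continuous_on_eq_continuous_at)
qed

lemma antiholomorphic_fun_on_imp_continuous_on:
  fixes A :: "('x::t2_space, complex ^ 'n::finite) chart set"
  assumes "smooth_atlas A" "open W" "antiholomorphic_fun_on A W f"
  shows "continuous_on W f"
proof (rule continuous_on_from_charts[OF assms(1,2)])
  fix c assume "c \<in> A"
  then have "isCont (f \<circ> inv_chart c) z" if "z \<in> chart_image c W" for z
    using assms(3) that has_derivative_continuous unfolding antiholomorphic_fun_on_def by blast
  then show "continuous_on (chart_image c W) (f \<circ> inv_chart c)"
    by (intro continuous_at_imp_continuous_on ballI)
qed

lemma smooth_fun_on_imp_continuous_on:
  fixes A :: "('x::t2_space, 'e::euclidean_space) chart set"
    and f :: "'x \<Rightarrow> 'b::real_normed_vector"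
  assumes "smooth_atlas A" "open W" "smooth_fun_on A W f"
  shows "continuous_on W f"
proof (rule continuous_on_from_charts[OF assms(1,2)])
  fix c assume "c \<in> A"
  then have "k_smooth_on 0 (chart_image c W) (f \<circ> inv_chart c)"
    using assms(3) unfolding smooth_fun_on_def smooth_on_def by blast
  then show "continuous_on (chart_image c W) (f \<circ> inv_chart c)" by simp
qed

section \<open>Pointwise norms of sections and bounded evaluation\<close>

text \<open>
  The norm of the fiber form. As in the fiber form the patch is \<open>triv E x\<close>, but on sections the
  value is the same in every patch around \<open>x\<close>.
\<close>

definition pointwise_norm ::
  "real \<Rightarrow> ('i, 'x) line_bundle \<Rightarrow> ('i, 'x) bsection \<Rightarrow> 'x \<Rightarrow> real" where
  "pointwise_norm h E u x =
     cmod (u (triv E x) x) * exp (- pot E (triv E x) x / (2 * h))"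

lemma pointwise_norm_nonneg: "pointwise_norm h E u x \<ge> 0"
  by (simp add: pointwise_norm_def)

lemma pointwise_norm_diff_le:
  "pointwise_norm h E (\<lambda>i x. u i x - v i x) x \<le> pointwise_norm h E u x + pointwise_norm h E v x"
  unfolding pointwise_norm_def distrib_right[symmetric]
  by (intro mult_right_mono norm_triangle_ineq4) simp

lemma exp_half_sq: "(exp (- p / (2 * h)))\<^sup>2 = exp (- p / h :: real)"
  by (simp add: exp_double[symmetric])

lemma cmod_fiber_form: "cmod (fiber_form h E u v x) = pointwise_norm h E u x * pointwise_norm h E v x"
  using exp_half_sq[of "pot E (triv E x) x" h]
  by (simp add: fiber_form_def pointwise_norm_def Let_def norm_mult power2_eq_square)

lemma fiber_form_self: "fiber_form h E u u x = of_real ((pointwise_norm h E u x)\<^sup>2)"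
  unfolding fiber_form_def pointwise_norm_def Let_def power_mult_distrib exp_half_sq of_real_mult
  by (simp only: complex_norm_square)

locale reproducing_bundle = section_hilbert_basis "section_space h A E m" "section_ip h n E m" B
  for h :: real and A :: "('x::t2_space, complex ^ 'n::finite) chart set"
    and E :: "('i, 'x) line_bundle" and m :: "'x measure" and n :: nat
    and B :: "('i, 'x) bsection set" +
  fixes \<omega> :: "('x, 'n) two_form"
  assumes h_pos: "h > 0" and atlas: "complex_atlas A"
    and hermitian: "hermitian_line_bundle h A \<omega> E"
    and reproducing: "reproducing_measure h A \<omega> E m B"
begin

abbreviation "V \<equiv> section_space h A E m"
abbreviation "ip \<equiv> section_ip h n E m"
abbreviation "pnorm \<equiv> pointwise_norm h E"
abbreviation "C \<equiv> 1 / (2 * pi * h) ^ n"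

lemma C_pos: "C > 0" using h_pos by simp

lemma sets_m: "sets m = sets borel"
  and open_pos: "open U \<Longrightarrow> U \<noteq> {} \<Longrightarrow> emeasure m U > 0"
  and kernel_diag_eq: "x \<in> patch E i \<Longrightarrow> kernel_diag B i x = exp (pot E i x / h)"
  using reproducing unfolding reproducing_measure_def by blast+

lemma smooth_atlas: "smooth_atlas A" using atlas unfolding complex_atlas_def by blast

lemma patch_open: "open (patch E i)"
  and patch_cover: "(\<Union>i. patch E i) = UNIV"
  and pot_smooth: "smooth_fun_on A (patch E i) (pot E i)"
  and pot_glue: "x \<in> patch E i \<inter> patch E j \<Longrightarrow>
     exp (- pot E j x / h) = (cmod (glue E i j x))\<^sup>2 * exp (- pot E i x / h)"
  using hermitian unfolding hermitian_line_bundle_def kahler_potential_def by blast+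

lemma in_triv: "x \<in> patch E (triv E x)"
  unfolding triv_def by (rule someI_ex) (use patch_cover in blast)

lemma section_glue: "u \<in> V \<Longrightarrow> x \<in> patch E i \<inter> patch E j \<Longrightarrow> u i x = glue E i j x * u j x"
  and section_antiholomorphic: "u \<in> V \<Longrightarrow> antiholomorphic_fun_on A (patch E i) (u i)"
  and section_integrable: "u \<in> V \<Longrightarrow> integrable m (fiber_form h E u u)"
  unfolding section_space_def antiholomorphic_section_def by blast+

text \<open>
  The transition functions of a section and of the weight \<open>exp (- F / h)\<close> cancel. Independence of
  the patch is what makes fiber forms continuous, the choice \<open>triv E x\<close> being arbitrary.
\<close>

lemma fiber_form_patch:
  assumes u: "u \<in> V" and v: "v \<in> V" and x: "x \<in> patch E i"
  shows "fiber_form h E u v x = u i x * cnj (v i x) * of_real (exp (- pot E i x / h))"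
proof -
  let ?t = "triv E x"
  have *: "x \<in> patch E ?t \<inter> patch E i" using x in_triv by blast
  show ?thesis
    unfolding fiber_form_def Let_def pot_glue[OF *] section_glue[OF u *] section_glue[OF v *]
      of_real_mult complex_norm_square
    by (simp add: mult_ac)
qed

lemma fiber_form_continuous:
  assumes u: "u \<in> V" and v: "v \<in> V"
  shows "continuous_on UNIV (fiber_form h E u v)"
proof (rule continuous_at_imp_continuous_on, rule ballI)
  fix x :: 'x
  obtain i where i: "x \<in> patch E i" using in_triv by blast
  have "continuous_on (patch E i) (\<lambda>x. u i x * cnj (v i x) * of_real (exp (- pot E i x / h)))"
    using h_pos
    by (intro continuous_intros smooth_fun_on_imp_continuous_on[OF smooth_atlas patch_open pot_smooth]
          antiholomorphic_fun_on_imp_continuous_on[OF smooth_atlas patch_open]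
          section_antiholomorphic u v) auto
  then have "continuous_on (patch E i) (fiber_form h E u v)"
    by (rule continuous_on_eq) (simp add: fiber_form_patch[OF u v])
  then show "isCont (fiber_form h E u v) x"
    using i patch_open by (simp add: continuous_on_eq_continuous_at)
qed

lemma fiber_form_measurable:
  assumes "u \<in> V" "v \<in> V"
  shows "fiber_form h E u v \<in> borel_measurable m"
  using borel_measurable_continuous_onI[OF fiber_form_continuous[OF assms]]
  by (simp add: measurable_cong_sets[OF sets_m refl])

lemma pnorm_eq_sqrt: "pnorm u x = sqrt (cmod (fiber_form h E u u x))"
  by (simp add: cmod_fiber_form pointwise_norm_nonneg)

lemma pnorm_continuous: "u \<in> V \<Longrightarrow> continuous_on UNIV (pnorm u)"
  unfolding pnorm_eq_sqrt by (intro continuous_intros fiber_form_continuous)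

lemma pnorm_sq_integrable: "u \<in> V \<Longrightarrow> integrable m (\<lambda>x. (pnorm u x)\<^sup>2)"
  using integrable_norm[OF section_integrable]
  by (simp add: cmod_fiber_form power2_eq_square)

lemma ip_norm_sq:
  assumes u: "u \<in> V"
  shows "(ip_norm ip u)\<^sup>2 = C * (LINT x|m. (pnorm u x)\<^sup>2)"
proof -
  have self: "fiber_form h E u u = (\<lambda>x. of_real ((pnorm u x)\<^sup>2))"
    by (rule ext) (rule fiber_form_self)
  have "of_real ((ip_norm ip u)\<^sup>2) = of_real C * (LINT x|m. complex_of_real ((pnorm u x)\<^sup>2))"
    using ip_self[OF u] unfolding section_ip_def[of h n E m u u] self by (rule sym)
  also have "\<dots> = of_real (C * (LINT x|m. (pnorm u x)\<^sup>2))"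
    by (simp only: integral_complex_of_real of_real_mult)
  finally show ?thesis by (simp only: of_real_eq_iff)
qed

lemma fiber_form_integrable:
  assumes u: "u \<in> V" and v: "v \<in> V"
  shows "integrable m (fiber_form h E u v)"
proof (rule Bochner_Integration.integrable_bound)
  show "integrable m (\<lambda>x. (pnorm u x)\<^sup>2 + (pnorm v x)\<^sup>2)"
    by (intro Bochner_Integration.integrable_add pnorm_sq_integrable u v)
  have "pnorm u x * pnorm v x \<le> (pnorm u x)\<^sup>2 + (pnorm v x)\<^sup>2" for x
    using sum_squares_bound[of "pnorm u x" "pnorm v x"]
      mult_nonneg_nonneg[OF pointwise_norm_nonneg[of h E u x] pointwise_norm_nonneg[of h E v x]]
    by linarith
  then show "AE x in m. norm (fiber_form h E u v x) \<le> norm ((pnorm u x)\<^sup>2 + (pnorm v x)\<^sup>2)"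
    by (simp add: cmod_fiber_form)
qed (rule fiber_form_measurable[OF u v])

text \<open>
  This is the normalization \<open>K = exp (F / h)\<close>. The family is summable because a divergent one would
  have \<open>K = 0\<close> by convention.
\<close>

lemma basis_pnorm_has_sum: "((\<lambda>b. (pnorm b x)\<^sup>2) has_sum 1) B"
proof -
  let ?t = "triv E x"
  have pos: "infsum (\<lambda>b. (cmod (b ?t x))\<^sup>2) B = exp (pot E ?t x / h)"
    using kernel_diag_eq[OF in_triv] by (simp add: kernel_diag_def)
  then have "(\<lambda>b. (cmod (b ?t x))\<^sup>2) summable_on B"
    using infsum_not_exists[of "\<lambda>b. (cmod (b ?t x))\<^sup>2" B] by fastforce
  then have "((\<lambda>b. (cmod (b ?t x))\<^sup>2) has_sum exp (pot E ?t x / h)) B"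
    using has_sum_infsum pos by fastforce
  from has_sum_cmult_left[OF this, of "exp (- pot E ?t x / h)"]
  show ?thesis
    unfolding pointwise_norm_def power_mult_distrib exp_half_sq by (simp add: exp_add[symmetric])
qed

lemma basis_pnorm_le:
  assumes "finite S" "S \<subseteq> B"
  shows "(\<Sum>b\<in>S. (pnorm b x)\<^sup>2) \<le> 1"
  by (rule has_sum_mono_neutral[OF has_sum_finite[OF assms(1)] basis_pnorm_has_sum])
     (use assms in auto)

lemma pnorm_basis_sum_le:
  assumes S: "finite S" "S \<subseteq> B"
  shows "pnorm (\<lambda>i x. \<Sum>b\<in>S. a b * b i x) x \<le> ip_norm ip (\<lambda>i x. \<Sum>b\<in>S. a b * b i x)"
proof -
  let ?w = "\<lambda>i x. \<Sum>b\<in>S. a b * b i x"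
  let ?e = "exp (- pot E (triv E x) x / (2 * h))"
  have "pnorm ?w x \<le> (\<Sum>b\<in>S. cmod (a b) * cmod (b (triv E x) x)) * ?e"
    unfolding pointwise_norm_def
    by (intro mult_right_mono order_trans[OF norm_sum]) (auto simp: norm_mult)
  also have "\<dots> = (\<Sum>b\<in>S. \<bar>cmod (a b)\<bar> * \<bar>pnorm b x\<bar>)"
    by (simp add: pointwise_norm_def sum_distrib_right mult.assoc)
  also have "\<dots> \<le> L2_set (\<lambda>b. cmod (a b)) S * L2_set (\<lambda>b. pnorm b x) S"
    by (rule L2_set_mult_ineq)
  also have "\<dots> \<le> L2_set (\<lambda>b. cmod (a b)) S * 1"
    using basis_pnorm_le[OF S, of x] by (intro mult_left_mono) (auto simp: L2_set_def intro: sum_nonneg)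
  also have "\<dots> = ip_norm ip ?w"
    using basis_sum_norm[OF S, of a] ip_norm_nonneg[OF basis_sum_mem[OF S, of a]]
    by (simp add: L2_set_def real_sqrt_unique)
  finally show ?thesis .
qed

text \<open>
  Evaluation is bounded on the span of \<open>B\<close> by the previous lemma, and the span is dense in the
  \<open>L\<^sup>2\<close> norm only. Suppose that \<open>|u(x)|\<close> exceeds \<open>\<parallel>u\<parallel>\<close> by \<open>d\<close>. Subtract from \<open>u\<close> a combination
  \<open>v0\<close> close to \<open>u\<close>; the remainder \<open>w\<close> is small in norm, but larger than \<open>d / 2\<close> on a neighbourhood
  \<open>U\<close> of \<open>x\<close>. For every still better combination \<open>v1\<close> the difference \<open>v1 - v0\<close> lies in the span, so
  it is uniformly small and cannot compensate \<open>w\<close>: on the fixed set \<open>U\<close> of positive measure,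
  \<open>u - v1\<close> stays above \<open>d / 8\<close>, although its \<open>L\<^sup>2\<close> norm is below
  any given \<open>\<eta>\<close>.
\<close>

lemma pnorm_le_ip_norm:
  assumes u: "u \<in> V"
  shows "pnorm u x \<le> ip_norm ip u"
proof (rule ccontr)
  assume less: "\<not> pnorm u x \<le> ip_norm ip u"
  define d where "d = pnorm u x - ip_norm ip u"
  have d: "d > 0" using less by (simp add: d_def)
  let ?w = "\<lambda>S a i x. \<Sum>b\<in>S. a b * b i x"
  obtain S0 a0 where S0: "finite S0" "S0 \<subseteq> B" and d0: "ip_dist ip u (?w S0 a0) < d / 4"
    using basis_dense[OF u, of "d / 4"] d by auto
  define v0 where "v0 = ?w S0 a0"
  have v0: "v0 \<in> V" unfolding v0_def by (rule basis_sum_mem[OF S0])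
  define w where "w = (\<lambda>i x. u i x - v0 i x)"
  have w: "w \<in> V" unfolding w_def by (rule diff_mem[OF u v0])
  have nw: "ip_norm ip w < d / 4" using d0 by (simp add: w_def v0_def ip_dist_def)
  have "ip_norm ip v0 \<le> ip_norm ip u + ip_norm ip w"
    using ip_norm_diff_le[OF u w] by (simp add: w_def)
  moreover have "pnorm u x \<le> pnorm w x + pnorm v0 x"
    using pointwise_norm_diff_le[of h E w "\<lambda>i x. - v0 i x" x]
    by (simp add: w_def pointwise_norm_def)
  moreover have "pnorm v0 x \<le> ip_norm ip v0"
    unfolding v0_def by (rule pnorm_basis_sum_le[OF S0])
  ultimately have wx: "pnorm w x > d / 2" using nw d by (simp add: d_def)
  define U where "U = {y. d / 2 < pnorm w y}"
  have openU: "open U" unfolding U_def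
    by (intro open_Collect_less continuous_on_const pnorm_continuous w)
  have U: "U \<in> sets m" using openU sets_m by simp
  have Upos: "emeasure m U > 0"
    using openU wx by (intro open_pos) (auto simp: U_def)
  have lower: "ennreal ((d / 8)\<^sup>2 * C) * emeasure m U \<le> ennreal (\<eta>\<^sup>2)"
    if eta: "0 < \<eta>" "\<eta> \<le> d / 8" for \<eta>
  proof -
    obtain S1 a1 where S1: "finite S1" "S1 \<subseteq> B" and d1: "ip_dist ip u (?w S1 a1) < \<eta>"
      using basis_dense[OF u eta(1)] by auto
    define v1 where "v1 = ?w S1 a1"
    have v1: "v1 \<in> V" unfolding v1_def by (rule basis_sum_mem[OF S1])
    define r where "r = (\<lambda>i x. u i x - v1 i x)"
    have r: "r \<in> V" unfolding r_def by (rule diff_mem[OF u v1])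
    have nr: "ip_norm ip r < \<eta>" using d1 by (simp add: r_def v1_def ip_dist_def)
    have "(\<lambda>i x. v1 i x - v0 i x) = ?w (S0 \<union> S1)
        (\<lambda>b. (if b \<in> S1 then a1 b else 0) - (if b \<in> S0 then a0 b else 0))"
    proof (intro ext)
      fix i x
      have "v1 i x = (\<Sum>b\<in>S0 \<union> S1. (if b \<in> S1 then a1 b else 0) * b i x)"
        unfolding v1_def using S0 S1 by (intro sum.mono_neutral_cong_left) auto
      moreover have "v0 i x = (\<Sum>b\<in>S0 \<union> S1. (if b \<in> S0 then a0 b else 0) * b i x)"
        unfolding v0_def using S0 S1 by (intro sum.mono_neutral_cong_left) auto
      ultimately show "v1 i x - v0 i x = ?w (S0 \<union> S1)
          (\<lambda>b. (if b \<in> S1 then a1 b else 0) - (if b \<in> S0 then a0 b else 0)) i x"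
        by (simp add: sum_subtractf left_diff_distrib)
    qed
    then have diff: "pnorm (\<lambda>i x. v1 i x - v0 i x) y \<le> ip_norm ip (\<lambda>i x. v1 i x - v0 i x)" for y
      using pnorm_basis_sum_le[of "S0 \<union> S1"] S0 S1 by simp
    have "ip_norm ip (\<lambda>i x. v1 i x - v0 i x) \<le> ip_norm ip w + ip_norm ip r"
      using ip_norm_diff_le[OF w r] by (simp add: w_def r_def)
    then have small: "pnorm (\<lambda>i x. v1 i x - v0 i x) y < 3 * d / 8" for y
      using diff[of y] nw nr eta by linarith
    have split: "pnorm w y \<le> pnorm r y + pnorm (\<lambda>i x. v1 i x - v0 i x) y" for y
      using pointwise_norm_diff_le[of h E r "\<lambda>i x. v0 i x - v1 i x" y]
      by (simp add: w_def r_def pointwise_norm_def norm_minus_commute)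
    have "d / 8 < pnorm r y" if "y \<in> U" for y
    proof -
      have "d / 2 < pnorm w y" using that by (simp add: U_def)
      with small[of y] split[of y] show ?thesis by linarith
    qed
    then have rU: "(d / 8)\<^sup>2 \<le> (pnorm r y)\<^sup>2" if "y \<in> U" for y
      using that d by (intro power_mono less_imp_le) auto
    have "ennreal ((d / 8)\<^sup>2 * C) * emeasure m U = (\<integral>\<^sup>+y. ennreal ((d / 8)\<^sup>2 * C) * indicator U y \<partial>m)"
      using U by (simp add: nn_integral_cmult_indicator)
    also have "\<dots> \<le> (\<integral>\<^sup>+y. ennreal (C * (pnorm r y)\<^sup>2) \<partial>m)"
      using rU C_pos
      by (intro nn_integral_mono) (auto simp: indicator_def mult.commute intro!: ennreal_leI divide_right_mono)
    also have "\<dots> = ennreal (LINT y|m. C * (pnorm r y)\<^sup>2)"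
      using C_pos pnorm_sq_integrable[OF r] by (intro nn_integral_eq_integral) auto
    also have "(LINT y|m. C * (pnorm r y)\<^sup>2) = (ip_norm ip r)\<^sup>2"
      unfolding ip_norm_sq[OF r] by (rule integral_mult_right_zero)
    also have "ennreal \<dots> \<le> ennreal (\<eta>\<^sup>2)"
      using nr ip_norm_nonneg[OF r] by (intro ennreal_leI power_mono) auto
    finally show ?thesis .
  qed
  define q where "q = enn2real (ennreal ((d / 8)\<^sup>2 * C) * emeasure m U)"
  have Q: "ennreal ((d / 8)\<^sup>2 * C) * emeasure m U = ennreal q"
    using lower[of "d / 8"] d unfolding q_def
    by (intro ennreal_enn2real[symmetric]) (auto simp: le_less_trans)
  have "ennreal ((d / 8)\<^sup>2 * C) * emeasure m U > 0"
    using Upos d C_pos by (simp add: ennreal_zero_less_mult_iff)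
  then have q: "q > 0" unfolding Q by simp
  define \<eta> where "\<eta> = min (d / 8) (sqrt (q / 2))"
  have eta: "0 < \<eta>" "\<eta> \<le> d / 8" using q d by (auto simp: \<eta>_def)
  have "\<eta>\<^sup>2 \<le> (sqrt (q / 2))\<^sup>2" using eta(1) by (intro power_mono) (auto simp: \<eta>_def)
  also have "\<dots> < q" using q by simp
  finally show False using lower[OF eta] q unfolding Q by (simp add: ennreal_le_iff2)
qed

lemma cmod_eq_pnorm:
  assumes "u \<in> V" "x \<in> patch E i"
  shows "cmod (u i x) = pnorm u x * exp (pot E i x / (2 * h))"
proof -
  have "(pnorm u x)\<^sup>2 = (cmod (u i x) * exp (- pot E i x / (2 * h)))\<^sup>2"
    using arg_cong[OF fiber_form_patch[OF assms(1,1,2)], of cmod]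
    unfolding cmod_fiber_form power_mult_distrib exp_half_sq
    by (simp add: norm_mult power2_eq_square)
  then have "pnorm u x = cmod (u i x) * exp (- pot E i x / (2 * h))"
    by (rule power2_eq_imp_eq) (simp_all add: pointwise_norm_nonneg)
  then show ?thesis by (simp add: exp_add[symmetric])
qed

lemma eval_tendsto:
  assumes s: "\<And>k. s k \<in> V" and u: "u \<in> V" and x: "x \<in> patch E i"
    and lim: "((\<lambda>k. ip_dist ip (s k) u) \<longlongrightarrow> 0) G"
  shows "((\<lambda>k. s k i x) \<longlongrightarrow> u i x) G"
proof (rule Lim_null[THEN iffD2], rule Lim_null_comparison)
  show "\<forall>\<^sub>F k in G. norm (s k i x - u i x) \<le> ip_dist ip (s k) u * exp (pot E i x / (2 * h))"
  proof (rule always_eventually, rule allI)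
    fix k
    have "norm (s k i x - u i x) = pnorm (\<lambda>i x. s k i x - u i x) x * exp (pot E i x / (2 * h))"
      by (rule cmod_eq_pnorm[OF diff_mem[OF s u] x])
    also have "\<dots> \<le> ip_dist ip (s k) u * exp (pot E i x / (2 * h))"
      unfolding ip_dist_def by (intro mult_right_mono pnorm_le_ip_norm diff_mem s u) simp
    finally show "norm (s k i x - u i x) \<le> ip_dist ip (s k) u * exp (pot E i x / (2 * h))" .
  qed
  show "((\<lambda>k. ip_dist ip (s k) u * exp (pot E i x / (2 * h))) \<longlongrightarrow> 0) G"
    using tendsto_mult_left_zero[OF lim] .
qed

lemma Fourier_has_sum:
  assumes u: "u \<in> V" and x: "x \<in> patch E i"
  shows "((\<lambda>b. ip u b * b i x) has_sum u i x) B"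
  unfolding has_sum_def
proof (rule Lim_transform_eventually)
  let ?s = "\<lambda>S. if finite S \<and> S \<subseteq> B then (\<lambda>i x. \<Sum>b\<in>S. ip u b * b i x) else (\<lambda>_ _. 0)"
  have "((\<lambda>S. ip_dist ip (?s S) u) \<longlongrightarrow> 0) (finite_subsets_at_top B)"
    by (rule Lim_transform_eventually[OF Fourier_tendsto[OF u]])
       (use eventually_basis_sum_mem in \<open>eventually_elim, simp\<close>)
  then show "((\<lambda>S. ?s S i x) \<longlongrightarrow> u i x) (finite_subsets_at_top B)"
    by (intro eval_tendsto[OF _ u x]) (auto intro: zero_mem basis_sum_mem)
  show "\<forall>\<^sub>F S in finite_subsets_at_top B. ?s S i x = (\<Sum>b\<in>S. ip u b * b i x)"
    using eventually_basis_sum_mem by eventually_elim auto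
qed

section \<open>Coherent sections, trace and dimension\<close>

text \<open>
  The coefficients \<open>cnj (b i x)\<close> are square-summable since \<open>K\<close> is finite at \<open>x\<close>, so they belong to
  a section. Bounded evaluation lets its Fourier series be evaluated pointwise, which identifies it
  with the kernel.
\<close>

lemma coherent_section:
  assumes x: "x \<in> patch E i"
  obtains g where "g \<in> V" "\<And>u. u \<in> V \<Longrightarrow> ip u g = u i x"
    "\<And>j y. y \<in> patch E j \<Longrightarrow> g j y = cnj (kernel B i j x y)"
proof -
  have "(\<lambda>b. (cmod (b i x))\<^sup>2) summable_on B"
    using infsum_not_exists[of "\<lambda>b. (cmod (b i x))\<^sup>2" B] kernel_diag_eq[OF x]
    by (fastforce simp: kernel_diag_def)
  then obtain g where g: "g \<in> V" and gb: "\<And>b. b \<in> B \<Longrightarrow> ip g b = cnj (b i x)"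
    using Riesz_Fischer[of "\<lambda>b. cnj (b i x)"] by auto
  have "ip u g = u i x" if u: "u \<in> V" for u
  proof -
    have "((\<lambda>b. ip u b * b i x) has_sum ip u g) B"
      using Parseval[OF u g]
      by (rule has_sum_cong[THEN iffD1, rotated]) (simp add: ip_cnj[OF g basis_mem] gb)
    then show ?thesis using Fourier_has_sum[OF u x] by (rule has_sum_unique)
  qed
  moreover have "g j y = cnj (kernel B i j x y)" if y: "y \<in> patch E j" for j y
  proof -
    have "((\<lambda>b. cnj (b i x * cnj (b j y))) has_sum g j y) B"
      using Fourier_has_sum[OF g y]
      by (rule has_sum_cong[THEN iffD1, rotated]) (simp add: gb)
    then have "(\<Sum>\<^sub>\<infinity>b\<in>B. cnj (b i x * cnj (b j y))) = g j y" by (rule infsumI)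
    then show ?thesis by (simp only: infsum_cnj kernel_def)
  qed
  ultimately show ?thesis using that g by blast
qed

text \<open>
  By Hermitian symmetry of the kernel, the integrand of the Wick operator on the coherent section
  contains \<open>|K\<^sup>#(x|y)|\<^sup>2 exp (- F(y) / h)\<close>. Since \<open>exp (- F / h) = 1 / K\<close>, this is the density of the
  Wick product with \<open>1\<close>, up to the factor \<open>K(x)\<close>.
\<close>

lemma wick_op_coherent:
  assumes x: "x \<in> patch E i" and i: "i = triv E x"
    and g: "\<And>j y. y \<in> patch E j \<Longrightarrow> g j y = cnj (kernel B i j x y)"
  shows "wick_op h n E m B \<Psi> g i x =
    of_real (exp (pot E i x / h)) * wick_prod h n E m B \<Psi> (\<lambda>_ _. 1) x"
proof -
  have "wick_op_integrand h E B \<Psi> g i x y =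
      of_real (exp (pot E i x / h)) * wick_prod_integrand E B \<Psi> (\<lambda>_ _. 1) x y" for y
  proof -
    let ?j = "triv E y"
    let ?k = "kernel B i ?j x y"
    have "wick_op_integrand h E B \<Psi> g i x y =
        (?k * cnj ?k) * \<Psi> x y * of_real (exp (- (pot E ?j y / h)))"
      by (simp add: wick_op_integrand_def Let_def g[OF in_triv] mult_ac)
    also have "\<dots> = of_real ((cmod ?k)\<^sup>2 / exp (pot E ?j y / h)) * \<Psi> x y"
      unfolding complex_norm_square[symmetric] by (simp add: exp_minus divide_inverse mult_ac)
    also have "(cmod ?k)\<^sup>2 / exp (pot E ?j y / h) =
        exp (pot E i x / h) * ((cmod ?k)\<^sup>2 / (kernel_diag B i x * kernel_diag B ?j y))"
      by (simp add: kernel_diag_eq[OF x] kernel_diag_eq[OF in_triv])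
    finally show ?thesis
      by (simp add: wick_prod_integrand_def Let_def i)
  qed
  then have "wick_op_integrand h E B \<Psi> g i x =
      (\<lambda>y. of_real (exp (pot E i x / h)) * wick_prod_integrand E B \<Psi> (\<lambda>_ _. 1) x y)"
    by (rule ext)
  then show ?thesis
    using x by (simp add: wick_op_def wick_prod_def)
qed

lemma fiber_form_norm_integral_le:
  assumes u: "u \<in> V" and v: "v \<in> V"
  shows "C * (LINT x|m. cmod (fiber_form h E u v x)) \<le> ip_norm ip u * ip_norm ip v"
proof (cases "ip_norm ip u = 0 \<or> ip_norm ip v = 0")
  case True
  then have "cmod (fiber_form h E u v x) = 0" for x unfolding cmod_fiber_form
    using pnorm_le_ip_norm[OF u, of x] pnorm_le_ip_norm[OF v, of x]
      pointwise_norm_nonneg[of h E u x] pointwise_norm_nonneg[of h E v x] by auto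
  then have "(LINT x|m. cmod (fiber_form h E u v x)) = 0" by (simp only: integral_zero)
  then show ?thesis using True by auto
next
  case False
  let ?u = "ip_norm ip u" and ?v = "ip_norm ip v"
  have pos: "?u > 0" "?v > 0"
    using False ip_norm_nonneg[OF u] ip_norm_nonneg[OF v] by auto
  \<comment> \<open>The arithmetic-geometric mean inequality, weighted so that both terms have the same integral.\<close>
  have amgm: "pnorm u x * pnorm v x \<le>
      ?v / (2 * ?u) * (pnorm u x)\<^sup>2 + ?u / (2 * ?v) * (pnorm v x)\<^sup>2" for x
  proof -
    have "0 \<le> (?v * pnorm u x - ?u * pnorm v x)\<^sup>2 / (2 * ?u * ?v)" using pos by simp
    also have "\<dots> = ?v / (2 * ?u) * (pnorm u x)\<^sup>2 + ?u / (2 * ?v) * (pnorm v x)\<^sup>2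
        - pnorm u x * pnorm v x"
      using pos by (simp add: power2_eq_square field_simps)
    finally show ?thesis by simp
  qed
  have "(LINT x|m. cmod (fiber_form h E u v x)) \<le>
      (LINT x|m. ?v / (2 * ?u) * (pnorm u x)\<^sup>2 + ?u / (2 * ?v) * (pnorm v x)\<^sup>2)"
    by (intro integral_mono integrable_norm fiber_form_integrable u v
         Bochner_Integration.integrable_add integrable_mult_right pnorm_sq_integrable)
       (simp only: cmod_fiber_form amgm)
  also have "\<dots> = ?v / (2 * ?u) * (LINT x|m. (pnorm u x)\<^sup>2) + ?u / (2 * ?v) * (LINT x|m. (pnorm v x)\<^sup>2)"
    using pnorm_sq_integrable[OF u] pnorm_sq_integrable[OF v] by simp
  finally have "C * (LINT x|m. cmod (fiber_form h E u v x)) \<le>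
      C * (?v / (2 * ?u) * (LINT x|m. (pnorm u x)\<^sup>2) + ?u / (2 * ?v) * (LINT x|m. (pnorm v x)\<^sup>2))"
    using C_pos by (intro mult_left_mono) auto
  also have "\<dots> = ?v / (2 * ?u) * (C * (LINT x|m. (pnorm u x)\<^sup>2))
      + ?u / (2 * ?v) * (C * (LINT x|m. (pnorm v x)\<^sup>2))"
    by (simp only: distrib_left mult.left_commute)
  also have "\<dots> = ?v / (2 * ?u) * ?u\<^sup>2 + ?u / (2 * ?v) * ?v\<^sup>2"
    by (simp only: ip_norm_sq[OF u] ip_norm_sq[OF v])
  also have "\<dots> = ?u * ?v"
    using pos by (simp add: power2_eq_square field_simps)
  finally show ?thesis .
qed

text \<open>
  Expanding \<open>T\<close> in rank one operators and evaluating at the coherent section at \<open>x\<close> writes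
  \<open>\<psi>(x)\<close> as the sum of the fiber forms of \<open>a k\<close> and \<open>c k\<close>; the termwise integral is the trace. The
  series is dominated pointwise and, up to the factor \<open>1 / C\<close>, in \<open>L\<^sup>1\<close>, by
  \<open>\<Sum>k. \<parallel>a k\<parallel> \<parallel>c k\<parallel>\<close>.
\<close>

lemma trace_formula:
  assumes tr: "trace_class V ip (wick_op h n E m B \<Psi>)"
    and unit: "\<And>x. wick_prod h n E m B \<Psi> (\<lambda>_ _. 1) x = \<psi> x"
  shows "integrable m \<psi>"
    and "op_trace V ip (wick_op h n E m B \<Psi>) = of_real C * (LINT x|m. \<psi> x)"
proof -
  let ?T = "wick_op h n E m B \<Psi>"
  have TV: "\<And>u. u \<in> V \<Longrightarrow> ?T u \<in> V" using tr unfolding trace_class_def by blast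
  obtain a c where a: "\<And>k::nat. a k \<in> V" and c: "\<And>k. c k \<in> V"
    and summ: "summable (\<lambda>k. ip_norm ip (a k) * ip_norm ip (c k))"
    and lim: "\<And>u. u \<in> V \<Longrightarrow>
        (\<lambda>N. ip_dist ip (?T u) (\<lambda>i x. \<Sum>k<N. ip u (c k) * a k i x)) \<longlonglongrightarrow> 0"
    using tr unfolding trace_class_def by blast
  let ?f = "\<lambda>k. fiber_form h E (a k) (c k)"
  have sums: "(\<lambda>k. ?f k x) sums \<psi> x" for x
  proof -
    let ?i = "triv E x"
    obtain g where g: "g \<in> V" and eval: "\<And>u. u \<in> V \<Longrightarrow> ip u g = u ?i x"
      and ker: "\<And>j y. y \<in> patch E j \<Longrightarrow> g j y = cnj (kernel B ?i j x y)"
      using coherent_section[OF in_triv, of x] by metis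
    let ?s = "\<lambda>N i x. \<Sum>k<N. ip g (c k) * a k i x"
    have s: "?s N \<in> V" for N using a by (intro sum_mem) auto
    have "(\<lambda>N. ip_dist ip (?s N) (?T g)) \<longlonglongrightarrow> 0"
      using lim[OF g] by (simp only: ip_dist_commute[OF TV[OF g] s])
    then have "(\<lambda>N. ?s N ?i x) \<longlonglongrightarrow> ?T g ?i x"
      by (intro eval_tendsto s TV g in_triv)
    then have "(\<lambda>k. ip g (c k) * a k ?i x) sums ?T g ?i x"
      by (simp add: sums_def)
    from sums_mult[OF this, of "of_real (exp (- pot E ?i x / h))"]
    have series: "(\<lambda>k. of_real (exp (- pot E ?i x / h)) * (ip g (c k) * a k ?i x)) sums
        (of_real (exp (- pot E ?i x / h)) * ?T g ?i x)" .
    have "?T g ?i x = of_real (exp (pot E ?i x / h)) * \<psi> x"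
      unfolding unit[symmetric] by (rule wick_op_coherent[OF in_triv refl ker])
    then have total: "of_real (exp (- pot E ?i x / h)) * ?T g ?i x = \<psi> x"
      by (simp add: mult.assoc[symmetric] exp_add[symmetric] flip: of_real_mult)
    have terms: "of_real (exp (- pot E ?i x / h)) * (ip g (c k) * a k ?i x) = ?f k x" for k
      unfolding fiber_form_def Let_def ip_cnj[OF c g] eval[OF c] by (simp add: mult_ac)
    show ?thesis using series unfolding total terms .
  qed
  have f_int: "integrable m (?f k)" for k by (rule fiber_form_integrable[OF a c])
  have f_AE: "AE x in m. summable (\<lambda>k. norm (?f k x))"
  proof (rule AE_I2)
    fix x
    show "summable (\<lambda>k. norm (?f k x))"
    proof (rule summable_comparison_test'[OF summ])
      fix k
      show "norm (norm (?f k x)) \<le> ip_norm ip (a k) * ip_norm ip (c k)"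
        unfolding real_norm_def abs_norm_cancel
        unfolding cmod_fiber_form
        by (intro mult_mono pnorm_le_ip_norm pointwise_norm_nonneg ip_norm_nonneg a c)
    qed
  qed
  have f_summ: "summable (\<lambda>k. LINT x|m. norm (?f k x))"
  proof (rule summable_comparison_test'[OF summable_mult[OF summ, of "1 / C"]])
    fix k
    show "norm (LINT x|m. norm (?f k x)) \<le> 1 / C * (ip_norm ip (a k) * ip_norm ip (c k))"
      using fiber_form_norm_integral_le[OF a c, of k k] C_pos
      by (simp add: field_simps)
  qed
  have \<psi>: "\<psi> = (\<lambda>x. \<Sum>k. ?f k x)" using sums by (auto simp: sums_iff)
  show "integrable m \<psi>"
    unfolding \<psi> by (rule integrable_suminf[OF f_int f_AE f_summ])
  have "(\<lambda>k. LINT x|m. ?f k x) sums (LINT x|m. \<psi> x)"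
    unfolding \<psi> by (rule sums_integral[OF f_int f_AE f_summ])
  from sums_mult[OF this, of "of_real C"]
  have "(\<lambda>k. ip (a k) (c k)) sums (of_real C * (LINT x|m. \<psi> x))"
    by (simp only: section_ip_def)
  then show "op_trace V ip ?T = of_real C * (LINT x|m. \<psi> x)"
    using op_trace_nuclear[OF hilbert basis TV a c summ lim] by (simp only: sums_iff)
qed

text \<open>
  For an infinite basis only finite parts of \<open>\<Sum>b. |b(x)|\<^sup>2 = 1\<close> are integrated: each of them is at
  most \<open>1\<close>, and its integral counts the members of the part, so the total mass times \<open>C\<close> is infinite.
  Finite parts avoid exchanging a possibly uncountable sum with the integral.
\<close>

lemma dimension_formula: "hilbert_dim V ip = ennreal C * (\<integral>\<^sup>+x. 1 \<partial>m)"
proof -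
  have card: "ennreal C * (\<integral>\<^sup>+x. ennreal (\<Sum>b\<in>S. (pnorm b x)\<^sup>2) \<partial>m) = of_nat (card S)"
    if S: "finite S" "S \<subseteq> B" for S
  proof -
    have int: "integrable m (\<lambda>x. \<Sum>b\<in>S. (pnorm b x)\<^sup>2)"
      using S by (intro Bochner_Integration.integrable_sum pnorm_sq_integrable basis_mem) auto
    have one: "C * (LINT x|m. (pnorm b x)\<^sup>2) = 1" if "b \<in> S" for b
    proof -
      have b: "b \<in> B" using that S by blast
      show ?thesis
        using ip_norm_sq[OF basis_mem[OF b]] ip_self[OF basis_mem[OF b]] basis_ip[OF b b]
        by (simp flip: of_real_power)
    qed
    have "ennreal C * (\<integral>\<^sup>+x. ennreal (\<Sum>b\<in>S. (pnorm b x)\<^sup>2) \<partial>m) =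
        ennreal C * ennreal (LINT x|m. (\<Sum>b\<in>S. (pnorm b x)\<^sup>2))"
      by (subst nn_integral_eq_integral[OF int]) (auto intro!: AE_I2 sum_nonneg)
    also have "\<dots> = ennreal (C * (LINT x|m. (\<Sum>b\<in>S. (pnorm b x)\<^sup>2)))"
      using C_pos by (intro ennreal_mult[symmetric] Bochner_Integration.integral_nonneg) (auto intro: sum_nonneg)
    also have "(LINT x|m. (\<Sum>b\<in>S. (pnorm b x)\<^sup>2)) = (\<Sum>b\<in>S. (LINT x|m. (pnorm b x)\<^sup>2))"
      using S by (intro Bochner_Integration.integral_sum pnorm_sq_integrable basis_mem) auto
    also have "C * \<dots> = real (card S)" using one by (simp only: sum_distrib_left sum.cong[OF refl one]) simp
    finally show ?thesis by (simp add: ennreal_of_nat_eq_real_of_nat)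
  qed
  show ?thesis
  proof (cases "finite B")
    case True
    have "(\<Sum>b\<in>B. (pnorm b x)\<^sup>2) = 1" for x
      using basis_pnorm_has_sum[of x] True by (simp add: has_sum_finite_iff)
    then show ?thesis
      using card[OF True] True by (simp add: hilbert_dim_basis)
  next
    case False
    have "of_nat N \<le> ennreal C * (\<integral>\<^sup>+x. 1 \<partial>m)" for N
    proof -
      obtain S where S: "finite S" "S \<subseteq> B" "card S = N"
        using infinite_arbitrarily_large[OF False] by blast
      have "of_nat N = ennreal C * (\<integral>\<^sup>+x. ennreal (\<Sum>b\<in>S. (pnorm b x)\<^sup>2) \<partial>m)"
        using card[OF S(1,2)] S(3) by simp
      also have "\<dots> \<le> ennreal C * (\<integral>\<^sup>+x. 1 \<partial>m)"
        using basis_pnorm_le[OF S(1,2)]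
        by (intro mult_left_mono nn_integral_mono) (auto simp: ennreal_le_1)
      finally show ?thesis .
    qed
    then have "ennreal C * (\<integral>\<^sup>+x. 1 \<partial>m) = \<infinity>"
      using ennreal_Ex_less_of_nat[of "ennreal C * (\<integral>\<^sup>+x. 1 \<partial>m)"]
      by (force simp: top.not_eq_extremum not_le[symmetric])
    then show ?thesis using False by (simp add: hilbert_dim_basis)
  qed
qed

end

theorem mainTheorem16:
  fixes h :: real and Hs :: "real set"
    and AM :: "('m::{t2_space, second_countable_topology}, real ^ 'd::finite) chart set"
    and AX :: "('x::{t2_space, second_countable_topology}, complex ^ 'n::finite) chart set"
    and br :: "('m \<Rightarrow> complex) \<Rightarrow> ('m \<Rightarrow> complex) \<Rightarrow> ('m \<Rightarrow> complex)"
    and F :: "('m \<Rightarrow> complex) set"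
    and star :: "real \<Rightarrow> ('m \<Rightarrow> complex) \<Rightarrow> ('m \<Rightarrow> complex) \<Rightarrow> ('m \<Rightarrow> complex)"
    and c :: "nat \<Rightarrow> ('m \<Rightarrow> complex) \<Rightarrow> ('m \<Rightarrow> complex) \<Rightarrow> ('m \<Rightarrow> complex)"
    and \<iota> :: "'x \<Rightarrow> 'm"
    and \<omega> :: "('x, 'n) two_form"
    and E :: "('i, 'x) line_bundle"
    and m :: "'x measure"
    and B :: "('i, 'x) bsection set"
    and rest :: "real \<Rightarrow> ('m \<Rightarrow> complex) \<Rightarrow> ('x \<Rightarrow> complex)"
    and e :: "nat \<Rightarrow> ('m \<Rightarrow> complex) \<Rightarrow> ('x \<Rightarrow> complex)"
  assumes "h > 0" and "Hs \<subseteq> {0<..}" and "h \<in> Hs" and "0 islimpt Hs"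
    and "smooth_atlas AM" and "poisson_bracket AM br"
    and "star_algebra AM F (star h)" and "star_deformation Hs F star c br"
    and "complex_atlas AX" and "symplectic_leaf AM br AX \<iota>"
    and "kahler_form AX \<omega>" and "integral_class AX \<omega> (2 * pi * h)"
    and "hermitian_line_bundle h AX \<omega> E"
    and "hilbert_space (section_space h AX E m) (section_ip h CARD('n) E m)"
    and "orthonormal_basis (section_space h AX E m) (section_ip h CARD('n) E m) B"
    and "reproducing_measure h AX \<omega> E m B"
    and "quantum_restriction h Hs AM AX \<iota> F rest e"
    and "restriction_multiplicative h CARD('n) AX E m B F (star h) (rest h)"
  shows "(\<forall>f\<in>F. \<forall>\<Psi>. sesqui_extension AX E B (rest h f) \<Psi> \<longrightarrow>
            wick_op_has_trace h CARD('n) AX E m B \<Psi> \<longrightarrow>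
              integrable m (rest h f) \<and>
              op_trace (section_space h AX E m) (section_ip h CARD('n) E m)
                  (wick_op h CARD('n) E m B \<Psi>)
                = of_real (1 / (2 * pi * h) ^ CARD('n)) * (LINT x|m. rest h f x))
       \<and> hilbert_dim (section_space h AX E m) (section_ip h CARD('n) E m)
           = ennreal (1 / (2 * pi * h) ^ CARD('n)) * (\<integral>\<^sup>+x. 1 \<partial>m)"
proof -
  interpret reproducing_bundle h AX E m "CARD('n)" B \<omega>
    using assms
    by (auto intro!: reproducing_bundle.intro section_hilbert_basis.intro section_hilbert_space.intro
        section_hilbert_basis_axioms.intro reproducing_bundle_axioms.intro)
  have one: "(\<lambda>_. 1) \<in> F" and unit: "\<And>f. f \<in> F \<Longrightarrow> star h f (\<lambda>_. 1) = f"
    using \<open>star_algebra AM F (star h)\<close> unfolding star_algebra_def by blast+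
  have "rest h (\<lambda>_. 1) = (\<lambda>_. 1)"
    using \<open>quantum_restriction h Hs AM AX \<iota> F rest e\<close> unfolding quantum_restriction_def by blast
  moreover have "antiholomorphic_fun_on AX W (\<lambda>_. 1)" "holomorphic_fun_on AX W (\<lambda>_. 1)" for W
    unfolding antiholomorphic_fun_on_def holomorphic_fun_on_def
    by (auto simp: o_def intro!: exI[of _ "\<lambda>_. 0"])
  ultimately have ext_one: "sesqui_extension AX E B (rest h (\<lambda>_. 1)) (\<lambda>_ _. 1)"
    by (simp add: sesqui_extension_def)
  have prod: "wick_prod h CARD('n) E m B \<Psi> (\<lambda>_ _. 1) x = rest h f x"
    if "f \<in> F" "sesqui_extension AX E B (rest h f) \<Psi>" for f \<Psi> x
    using \<open>restriction_multiplicative h CARD('n) AX E m B F (star h) (rest h)\<close> that one ext_one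
      unit[OF that(1)]
    unfolding restriction_multiplicative_def by metis
  show ?thesis
  proof (intro conjI ballI allI impI)
    fix f \<Psi>
    assume f: "f \<in> F" "sesqui_extension AX E B (rest h f) \<Psi>"
      and "wick_op_has_trace h CARD('n) AX E m B \<Psi>"
    then have tr: "trace_class V ip (wick_op h CARD('n) E m B \<Psi>)"
      unfolding wick_op_has_trace_def by blast
    note formula = trace_formula[OF tr prod[OF f]]
    show "integrable m (rest h f)" by (rule formula(1))
    show "op_trace V ip (wick_op h CARD('n) E m B \<Psi>) = of_real C * (LINT x|m. rest h f x)"
      by (rule formula(2))
  qed (rule dimension_formula)
qed

end
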